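(* Let $\pi$ be a positive continuous probability density on $\mathbb{R}$, and let $q:\mathbb{R}^2\to[0,\infty)$ be a bounded continuous function such that $q(x,\cdot)$ is a probability density for every $x\in\mathbb{R}$ and such that, for some $s>0$, $q(x,x+u)=0$ whenever $|u|>s$ (for all $x$). Let $P$ be the associated Metropolis–Hastings operator on $L^2(\pi)$ and $r(\cdot)$, $t(\cdot,\cdot)$ as in the context. For $a>0$ set $$r_a:=\sup_{|x|\le a} r(x),\quad r_a':=\sup_{|x|>a} r(x),\quad \beta_a:=\int_{-s}^{s}\sup_{|x|>a}\sqrt{t(x,x+u)\,t(x+u,x)}\,du,$$ and $\alpha_a:=\max(r_a,\ r_a'+\beta_a)$. Then for every $a>0$, the essential spectral radius of $P$ on $L^2(\pi)$ satisfies $r_{ess}(P)\le \alpha_a$.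
   Context: Define $t(x,y):=\min\big(q(x,y),\ \pi(y)q(y,x)/\pi(x)\big)$ and $r(x):=1-\int_{\mathbb{R}} t(x,y)\,dy$. The Metropolis–Hastings operator is $(Pf)(x)=r(x)f(x)+\int_{\mathbb{R}} f(y)\,t(x,y)\,dy$, acting on $L^2(\pi)$, the $L^2$ space of the probability measure $\pi(y)\,dy$ (complex-valued functions), with operator norm $\|\cdot\|_2$. The essential spectral radius is $r_{ess}(P):=\lim_{n}\big(\inf_K\|P^n-K\|_2\big)^{1/n}$, the infimum being over compact operators $K$ on $L^2(\pi)$. *)

theory Defs
  imports "HOL-Analysis.Analysis"
begin

definition mh_t :: "(real \<Rightarrow> real) \<Rightarrow> (real \<Rightarrow> real \<Rightarrow> real) \<Rightarrow> real \<Rightarrow> real \<Rightarrow> real" where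
  "mh_t \<pi> q x y = min (q x y) (\<pi> y * q y x / \<pi> x)"

definition mh_r :: "(real \<Rightarrow> real) \<Rightarrow> (real \<Rightarrow> real \<Rightarrow> real) \<Rightarrow> real \<Rightarrow> real" where
  "mh_r \<pi> q x = 1 - (\<integral>y. mh_t \<pi> q x y \<partial>lborel)"

definition mh_op :: "(real \<Rightarrow> real) \<Rightarrow> (real \<Rightarrow> real \<Rightarrow> real) \<Rightarrow> (real \<Rightarrow> complex) \<Rightarrow> (real \<Rightarrow> complex)" where
  "mh_op \<pi> q f = (\<lambda>x. complex_of_real (mh_r \<pi> q x) * f x
                      + (\<integral>y. f y * complex_of_real (mh_t \<pi> q x y) \<partial>lborel))"

text \<open>The probability measure pi(y) dy and the space L^2(pi) (as a space of representatives,
  with the L^2 seminorm).\<close>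

definition pi_measure :: "(real \<Rightarrow> real) \<Rightarrow> real measure" where
  "pi_measure \<pi> = density lborel (\<lambda>x. ennreal (\<pi> x))"

definition L2 :: "(real \<Rightarrow> real) \<Rightarrow> (real \<Rightarrow> complex) set" where
  "L2 \<pi> = {f. f \<in> borel_measurable (pi_measure \<pi>)
              \<and> integrable (pi_measure \<pi>) (\<lambda>x. (cmod (f x))\<^sup>2)}"

definition L2norm :: "(real \<Rightarrow> real) \<Rightarrow> (real \<Rightarrow> complex) \<Rightarrow> real" where
  "L2norm \<pi> f = sqrt (\<integral>x. (cmod (f x))\<^sup>2 \<partial>pi_measure \<pi>)"

text \<open>Compact operators on L^2(pi): linear (up to a.e. equality), mapping L^2 to L^2,
  and mapping the closed unit ball to a relatively compact set (every sequence in the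
  unit ball has a subsequence whose image is Cauchy; L^2 is complete).\<close>

definition L2_compact_op :: "(real \<Rightarrow> real) \<Rightarrow> ((real \<Rightarrow> complex) \<Rightarrow> (real \<Rightarrow> complex)) \<Rightarrow> bool" where
  "L2_compact_op \<pi> K \<longleftrightarrow>
     (\<forall>f\<in>L2 \<pi>. K f \<in> L2 \<pi>) \<and>
     (\<forall>f\<in>L2 \<pi>. \<forall>g\<in>L2 \<pi>. \<forall>c::complex.
        AE x in pi_measure \<pi>. K (\<lambda>y. c * f y + g y) x = c * K f x + K g x) \<and>
     (\<forall>fs::nat \<Rightarrow> real \<Rightarrow> complex. (\<forall>n. fs n \<in> L2 \<pi> \<and> L2norm \<pi> (fs n) \<le> 1) \<longrightarrow>
        (\<exists>\<phi>::nat \<Rightarrow> nat. strict_mono \<phi> \<and>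
           (\<forall>e::real>0. \<exists>N::nat. \<forall>m\<ge>N. \<forall>n\<ge>N.
              L2norm \<pi> (\<lambda>x. K (fs (\<phi> m)) x - K (fs (\<phi> n)) x) < e)))"

definition L2_opnorm :: "(real \<Rightarrow> real) \<Rightarrow> ((real \<Rightarrow> complex) \<Rightarrow> (real \<Rightarrow> complex)) \<Rightarrow> real" where
  "L2_opnorm \<pi> T = (SUP f\<in>{f\<in>L2 \<pi>. L2norm \<pi> f \<le> 1}. L2norm \<pi> (T f))"

definition ess_spec_radius :: "(real \<Rightarrow> real) \<Rightarrow> ((real \<Rightarrow> complex) \<Rightarrow> (real \<Rightarrow> complex)) \<Rightarrow> real" where
  "ess_spec_radius \<pi> T =
     lim (\<lambda>n. (INF K\<in>{K. L2_compact_op \<pi> K}.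
                 L2_opnorm \<pi> (\<lambda>f x. (T ^^ n) f x - K f x)) powr (1 / real n))"

end

theory Submission
  imports Defs "HOL-Complex_Analysis.Great_Picard"
begin

text \<open>
  Split \<open>P = D + K\<close>, where \<open>K\<close> is the integral operator with kernel \<open>t(x,y)\<close> restricted to
  \<open>\<bar>x\<bar> \<le> a\<close> or \<open>\<bar>y\<bar> \<le> a\<close>. Since \<open>t\<close> is continuous and vanishes for \<open>\<bar>x - y\<bar> > s\<close>, the Arzela--Ascoli
  theorem shows that \<open>K\<close> is compact. The operator \<open>D\<close> is block diagonal: on \<open>[-a, a]\<close> it is the
  multiplication by \<open>r\<close>, and on the complement it is \<open>r\<close> plus an integral operator which, by detailed
  balance, is conjugate to one on \<open>L\<^sup>2(dx)\<close> with kernel \<open>sqrt (t(x,y) t(y,x))\<close>; a convolution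
  estimate bounds the latter by \<open>\<beta>\<^sub>a\<close>. Hence the norm of \<open>P\<close> modulo compact operators is at most
  \<open>\<alpha>\<^sub>a\<close>. These essential norms are submultiplicative on the powers of \<open>P\<close>, so by Fekete's lemma the
  limit defining the essential spectral radius exists, and it is at most the essential norm of \<open>P\<close>.
\<close>

section \<open>The seminorm of \<open>L\<^sup>2(\<pi>)\<close>\<close>

text \<open>Operators act on representatives, and a compact operator is only required to be linear
  almost everywhere; its definition mentions neither boundedness nor functions that agree almost
  everywhere. Both properties have to be extracted from the precompactness of the image of the unit
  ball, before compact operators can be composed and before the real-valued \<open>SUP\<close> and
  \<open>INF\<close> in the norms act as genuine bounds.

  Cutting at \<open>a\<close> pays off because the two diagonal blocks have inputs and outputs with
  disjoint supports: their norms combine by Pythagoras to a maximum, where the triangle inequality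
  would give a sum. Inside the outer block, multiplication by \<open>r\<close> and the integral
  operator act on the same functions, so there the norms do add, which is the origin of
  \<open>r_a' + \<beta>_a\<close>. The finite range \<open>s\<close> confines the coupling between
  the blocks to a bounded window, where compactness is available.\<close>

lemma L2_measurable: "f \<in> L2 \<pi> \<Longrightarrow> f \<in> borel_measurable borel"
  by (auto simp: L2_def pi_measure_def)

lemma L2_integrable: "f \<in> L2 \<pi> \<Longrightarrow> integrable (pi_measure \<pi>) (\<lambda>x. (cmod (f x))\<^sup>2)"
  by (auto simp: L2_def)

lemma L2I_bound:
  assumes "f \<in> borel_measurable borel" "integrable (pi_measure \<pi>) g"
    "\<And>x. (cmod (f x))\<^sup>2 \<le> g x"
  shows "f \<in> L2 \<pi>"
proof -
  have [measurable]: "f \<in> borel_measurable (pi_measure \<pi>)"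
    using assms(1) by (simp add: pi_measure_def)
  have "integrable (pi_measure \<pi>) (\<lambda>x. (cmod (f x))\<^sup>2)"
    by (rule Bochner_Integration.integrable_bound[OF assms(2)])
      (use assms(3) in \<open>auto intro!: AE_I2 order_trans[OF _ abs_ge_self]\<close>)
  then show ?thesis by (simp add: L2_def)
qed

lemma L2_lincomb:
  assumes "f \<in> L2 \<pi>" "g \<in> L2 \<pi>"
  shows "(\<lambda>x. c * f x + g x) \<in> L2 \<pi>"
proof (rule L2I_bound)
  show "(\<lambda>x. c * f x + g x) \<in> borel_measurable borel"
    using assms[THEN L2_measurable] by measurable
  show "integrable (pi_measure \<pi>) (\<lambda>x. 2 * (cmod c)\<^sup>2 * (cmod (f x))\<^sup>2 + 2 * (cmod (g x))\<^sup>2)"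
    using assms[THEN L2_integrable] by auto
  fix x
  have "(cmod (c * f x + g x))\<^sup>2 \<le> (cmod c * cmod (f x) + cmod (g x))\<^sup>2"
    by (intro power_mono) (auto simp: norm_mult[symmetric] norm_triangle_ineq)
  also have "\<dots> \<le> 2 * (cmod c)\<^sup>2 * (cmod (f x))\<^sup>2 + 2 * (cmod (g x))\<^sup>2"
    using sum_squares_bound[of "cmod c * cmod (f x)" "cmod (g x)"]
    by (simp add: power2_sum power_mult_distrib)
  finally show "(cmod (c * f x + g x))\<^sup>2 \<le> 2 * (cmod c)\<^sup>2 * (cmod (f x))\<^sup>2 + 2 * (cmod (g x))\<^sup>2" .
qed

lemma L2_zero: "(\<lambda>x. 0) \<in> L2 \<pi>"
  by (rule L2I_bound[where g = "\<lambda>_. 0"]) auto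

lemma L2_add: "f \<in> L2 \<pi> \<Longrightarrow> g \<in> L2 \<pi> \<Longrightarrow> (\<lambda>x. f x + g x) \<in> L2 \<pi>"
  using L2_lincomb[of f \<pi> g 1] by simp

lemma L2_diff: "f \<in> L2 \<pi> \<Longrightarrow> g \<in> L2 \<pi> \<Longrightarrow> (\<lambda>x. f x - g x) \<in> L2 \<pi>"
  using L2_lincomb[of g \<pi> f "-1"] by simp

lemma L2_cmult: "f \<in> L2 \<pi> \<Longrightarrow> (\<lambda>x. c * f x) \<in> L2 \<pi>"
  using L2_lincomb[OF _ L2_zero, of f \<pi> c] by simp

lemma L2_mult_bounded:
  assumes "f \<in> L2 \<pi>" "h \<in> borel_measurable borel" "\<And>x. cmod (h x) \<le> C"
  shows "(\<lambda>x. h x * f x) \<in> L2 \<pi>"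
proof (rule L2I_bound)
  show "(\<lambda>x. h x * f x) \<in> borel_measurable borel"
    using assms(2) L2_measurable[OF assms(1)] by measurable
  show "integrable (pi_measure \<pi>) (\<lambda>x. C\<^sup>2 * (cmod (f x))\<^sup>2)"
    using L2_integrable[OF assms(1)] by auto
  show "(cmod (h x * f x))\<^sup>2 \<le> C\<^sup>2 * (cmod (f x))\<^sup>2" for x
    using assms(3)[of x] by (auto simp: norm_mult power_mult_distrib intro!: mult_right_mono power_mono)
qed

lemma L2norm_nonneg [simp]: "L2norm \<pi> f \<ge> 0"
  by (simp add: L2norm_def)

lemma L2norm_power2: "(L2norm \<pi> f)\<^sup>2 = (\<integral>x. (cmod (f x))\<^sup>2 \<partial>pi_measure \<pi>)"
  by (simp add: L2norm_def)

lemma L2norm_zero [simp]: "L2norm \<pi> (\<lambda>x. 0) = 0"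
  by (simp add: L2norm_def)

lemma L2norm_cmult: "L2norm \<pi> (\<lambda>x. c * f x) = cmod c * L2norm \<pi> f"
  by (simp add: L2norm_def norm_mult power_mult_distrib real_sqrt_mult)

lemma L2norm_mono_AE:
  assumes "f \<in> L2 \<pi>" "g \<in> L2 \<pi>" "AE x in pi_measure \<pi>. cmod (f x) \<le> cmod (g x)"
  shows "L2norm \<pi> f \<le> L2norm \<pi> g"
  unfolding L2norm_def using assms(3)
  by (intro real_sqrt_le_mono integral_mono_AE L2_integrable assms) (auto intro: power_mono)

lemma L2norm_cong_AE:
  assumes "f \<in> L2 \<pi>" "g \<in> L2 \<pi>" "AE x in pi_measure \<pi>. f x = g x"
  shows "L2norm \<pi> f = L2norm \<pi> g"
  by (intro antisym L2norm_mono_AE assms; use assms(3) in auto)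

lemma L2norm_eq_0_imp_AE:
  assumes "f \<in> L2 \<pi>" "L2norm \<pi> f = 0"
  shows "AE x in pi_measure \<pi>. f x = 0"
proof -
  have "(\<integral>x. (cmod (f x))\<^sup>2 \<partial>pi_measure \<pi>) = 0"
    using assms(2) L2norm_power2[of \<pi> f] by simp
  then have "AE x in pi_measure \<pi>. (cmod (f x))\<^sup>2 = 0"
    using integral_nonneg_eq_0_iff_AE[OF L2_integrable[OF assms(1)]] by simp
  then show ?thesis by simp
qed

lemma L2norm_triangle:
  assumes f: "f \<in> L2 \<pi>" and g: "g \<in> L2 \<pi>"
  shows "L2norm \<pi> (\<lambda>x. f x + g x) \<le> L2norm \<pi> f + L2norm \<pi> g"
proof -
  define F G where "F = L2norm \<pi> f" and "G = L2norm \<pi> g"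
  \<comment> \<open>The weights used below divide by both norms. A function of norm zero vanishes
    almost everywhere, so these cases reduce to an a.e. equality.\<close>
  consider "F = 0" | "G = 0" | "F > 0" "G > 0"
    unfolding F_def G_def using L2norm_nonneg[of \<pi> f] L2norm_nonneg[of \<pi> g] by linarith
  then show ?thesis
  proof cases
    case 1
    then have "AE x in pi_measure \<pi>. f x + g x = g x"
      using L2norm_eq_0_imp_AE[OF f] by (auto simp: F_def)
    then show ?thesis using L2norm_cong_AE[OF L2_add[OF f g] g] by simp
  next
    case 2
    then have "AE x in pi_measure \<pi>. f x + g x = f x"
      using L2norm_eq_0_imp_AE[OF g] by (auto simp: G_def)
    then show ?thesis using L2norm_cong_AE[OF L2_add[OF f g] f] by simp
  next
    case 3
    \<comment> \<open>The weights are chosen so that the bound integrates to \<open>(F + G)\<^sup>2\<close>.\<close>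
    have key: "(u + v)\<^sup>2 \<le> (1 + G/F) * u\<^sup>2 + (1 + F/G) * v\<^sup>2" for u v :: real
    proof -
      have "0 \<le> (G * u - F * v)\<^sup>2 / (F * G)" using 3 by auto
      also have "\<dots> = (1 + G/F) * u\<^sup>2 + (1 + F/G) * v\<^sup>2 - (u + v)\<^sup>2"
        using 3 by (simp add: field_simps power2_eq_square)
      finally show ?thesis by simp
    qed
    have "(L2norm \<pi> (\<lambda>x. f x + g x))\<^sup>2
        \<le> (\<integral>x. (1 + G/F) * (cmod (f x))\<^sup>2 + (1 + F/G) * (cmod (g x))\<^sup>2 \<partial>pi_measure \<pi>)"
      unfolding L2norm_power2
    proof (rule integral_mono)
      show "integrable (pi_measure \<pi>) (\<lambda>x. (cmod (f x + g x))\<^sup>2)"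
        by (rule L2_integrable[OF L2_add[OF f g]])
      show "integrable (pi_measure \<pi>) (\<lambda>x. (1 + G/F) * (cmod (f x))\<^sup>2 + (1 + F/G) * (cmod (g x))\<^sup>2)"
        using L2_integrable[OF f] L2_integrable[OF g] by auto
      show "(cmod (f x + g x))\<^sup>2 \<le> (1 + G/F) * (cmod (f x))\<^sup>2 + (1 + F/G) * (cmod (g x))\<^sup>2" for x
        by (rule order_trans[OF power_mono[OF norm_triangle_ineq] key]) auto
    qed
    also have "\<dots> = (1 + G/F) * F\<^sup>2 + (1 + F/G) * G\<^sup>2"
      using L2_integrable[OF f] L2_integrable[OF g] by (simp add: F_def G_def L2norm_power2)
    also have "\<dots> = (F\<^sup>2 + F * G) + (G\<^sup>2 + F * G)"
      using 3 by (simp add: distrib_right power2_eq_square)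
    also have "\<dots> = (F + G)\<^sup>2"
      by (simp add: power2_sum)
    finally have "L2norm \<pi> (\<lambda>x. f x + g x) \<le> F + G"
      by (rule power2_le_imp_le) (use 3 in simp)
    then show ?thesis by (simp add: F_def G_def)
  qed
qed

text \<open>Pythagoras for disjoint supports. It makes the norm of a block diagonal operator the
  maximum of the norms of its blocks.\<close>

lemma L2norm_split:
  assumes g: "g \<in> L2 \<pi>" and A: "A \<in> sets borel"
  shows "(L2norm \<pi> g)\<^sup>2 = (L2norm \<pi> (\<lambda>x. indicator A x * g x))\<^sup>2
    + (L2norm \<pi> (\<lambda>x. indicator (- A) x * g x))\<^sup>2"
proof -
  have "(\<lambda>x. indicator B x * g x) \<in> L2 \<pi>" if "B \<in> sets borel" for B
    by (rule L2_mult_bounded[OF g, where C = 1]) (use that in \<open>auto simp: indicator_def\<close>)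
  then have "integrable (pi_measure \<pi>) (\<lambda>x. (cmod (indicator A x * g x))\<^sup>2)"
    "integrable (pi_measure \<pi>) (\<lambda>x. (cmod (indicator (- A) x * g x))\<^sup>2)"
    using A by (auto intro!: L2_integrable borel_comp)
  note Bochner_Integration.integral_add[OF this]
  moreover have "(cmod (g x))\<^sup>2 = (cmod (indicator A x * g x))\<^sup>2 + (cmod (indicator (- A) x * g x))\<^sup>2" for x
    by (simp add: indicator_def)
  ultimately show ?thesis
    unfolding L2norm_power2 by presburger
qed

section \<open>Bounded and compact operators on \<open>L\<^sup>2(\<pi>)\<close>\<close>

text \<open>The linear and the sequential clauses of \<open>L2_compact_op\<close> get names of their
  own, so that closure properties can be proved one clause at a time.\<close>

definition L2_linear_op :: "(real \<Rightarrow> real) \<Rightarrow> ((real \<Rightarrow> complex) \<Rightarrow> (real \<Rightarrow> complex)) \<Rightarrow> bool" where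
  "L2_linear_op \<pi> S \<longleftrightarrow> (\<forall>f\<in>L2 \<pi>. S f \<in> L2 \<pi>) \<and>
     (\<forall>f\<in>L2 \<pi>. \<forall>g\<in>L2 \<pi>. \<forall>c::complex.
        AE x in pi_measure \<pi>. S (\<lambda>y. c * f y + g y) x = c * S f x + S g x)"

definition L2_bounded_op :: "(real \<Rightarrow> real) \<Rightarrow> ((real \<Rightarrow> complex) \<Rightarrow> (real \<Rightarrow> complex)) \<Rightarrow> bool" where
  "L2_bounded_op \<pi> S \<longleftrightarrow> L2_linear_op \<pi> S \<and>
     (\<exists>C\<ge>0. \<forall>f\<in>L2 \<pi>. L2norm \<pi> (S f) \<le> C * L2norm \<pi> f)"

definition L2_unit_precompact :: "(real \<Rightarrow> real) \<Rightarrow> ((real \<Rightarrow> complex) \<Rightarrow> (real \<Rightarrow> complex)) \<Rightarrow> bool" where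
  "L2_unit_precompact \<pi> K \<longleftrightarrow>
     (\<forall>fs::nat \<Rightarrow> real \<Rightarrow> complex. (\<forall>n. fs n \<in> L2 \<pi> \<and> L2norm \<pi> (fs n) \<le> 1) \<longrightarrow>
        (\<exists>\<phi>::nat \<Rightarrow> nat. strict_mono \<phi> \<and>
           (\<forall>e::real>0. \<exists>N::nat. \<forall>m\<ge>N. \<forall>n\<ge>N.
              L2norm \<pi> (\<lambda>x. K (fs (\<phi> m)) x - K (fs (\<phi> n)) x) < e)))"

lemma L2_compact_op_iff: "L2_compact_op \<pi> K \<longleftrightarrow> L2_linear_op \<pi> K \<and> L2_unit_precompact \<pi> K"
  unfolding L2_compact_op_def L2_linear_op_def L2_unit_precompact_def by blast

lemma L2_unit_precompactD:
  assumes "L2_unit_precompact \<pi> K" "\<And>n::nat. fs n \<in> L2 \<pi>" "\<And>n. L2norm \<pi> (fs n) \<le> 1"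
  obtains \<phi> :: "nat \<Rightarrow> nat" where "strict_mono \<phi>"
    "\<And>e. e > 0 \<Longrightarrow> \<exists>N. \<forall>m\<ge>N. \<forall>n\<ge>N. L2norm \<pi> (\<lambda>x. K (fs (\<phi> m)) x - K (fs (\<phi> n)) x) < e"
  using assms unfolding L2_unit_precompact_def by metis

lemma L2_linear_op_in: "L2_linear_op \<pi> S \<Longrightarrow> f \<in> L2 \<pi> \<Longrightarrow> S f \<in> L2 \<pi>"
  by (simp add: L2_linear_op_def)

lemma L2_linear_op_lincomb:
  "L2_linear_op \<pi> S \<Longrightarrow> f \<in> L2 \<pi> \<Longrightarrow> g \<in> L2 \<pi> \<Longrightarrow>
     AE x in pi_measure \<pi>. S (\<lambda>y. c * f y + g y) x = c * S f x + S g x"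
  by (simp add: L2_linear_op_def)

lemma L2_linear_op_diff:
  assumes "L2_linear_op \<pi> S" "f \<in> L2 \<pi>" "g \<in> L2 \<pi>"
  shows "AE x in pi_measure \<pi>. S (\<lambda>y. f y - g y) x = S f x - S g x"
  using L2_linear_op_lincomb[OF assms(1,3,2), of "-1"] by simp

lemma L2_linear_op_cmult:
  assumes "L2_linear_op \<pi> S" "f \<in> L2 \<pi>"
  shows "AE x in pi_measure \<pi>. S (\<lambda>y. c * f y) x = c * S f x"
proof -
  \<comment> \<open>Linearity is given only for combinations \<open>c * f + g\<close>, so scaling
    needs the image of zero, obtained here from \<open>f - f\<close>.\<close>
  have "AE x in pi_measure \<pi>. S (\<lambda>y. f y - f y) x = S f x - S f x"
    by (rule L2_linear_op_diff[OF assms assms(2)])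
  then have "AE x in pi_measure \<pi>. S (\<lambda>y. 0) x = 0" by simp
  with L2_linear_op_lincomb[OF assms L2_zero, of c] show ?thesis by auto
qed

lemma L2_linear_op_lincomb_op:
  assumes S: "L2_linear_op \<pi> S" and T: "L2_linear_op \<pi> T"
  shows "L2_linear_op \<pi> (\<lambda>f x. d * S f x + T f x)"
  unfolding L2_linear_op_def
proof (intro conjI ballI allI)
  fix f assume f: "f \<in> L2 \<pi>"
  show "(\<lambda>x. d * S f x + T f x) \<in> L2 \<pi>"
    by (intro L2_lincomb L2_linear_op_in[OF S] L2_linear_op_in[OF T] f)
  fix g c assume g: "g \<in> L2 \<pi>"
  show "AE x in pi_measure \<pi>. d * S (\<lambda>y. c * f y + g y) x + T (\<lambda>y. c * f y + g y) x
      = c * (d * S f x + T f x) + (d * S g x + T g x)"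
    using L2_linear_op_lincomb[OF S f g, of c] L2_linear_op_lincomb[OF T f g, of c]
    by eventually_elim (simp add: algebra_simps)
qed

lemma L2_bounded_op_linear: "L2_bounded_op \<pi> S \<Longrightarrow> L2_linear_op \<pi> S"
  by (simp add: L2_bounded_op_def)

lemma L2_bounded_op_in: "L2_bounded_op \<pi> S \<Longrightarrow> f \<in> L2 \<pi> \<Longrightarrow> S f \<in> L2 \<pi>"
  by (simp add: L2_bounded_op_def L2_linear_op_def)

lemma L2_bounded_opE:
  assumes "L2_bounded_op \<pi> S"
  obtains C where "C > 0" "\<And>f. f \<in> L2 \<pi> \<Longrightarrow> L2norm \<pi> (S f) \<le> C * L2norm \<pi> f"
proof -
  obtain C where C: "C \<ge> 0" "\<And>f. f \<in> L2 \<pi> \<Longrightarrow> L2norm \<pi> (S f) \<le> C * L2norm \<pi> f"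
    using assms by (auto simp: L2_bounded_op_def)
  have "L2norm \<pi> (S f) \<le> (C + 1) * L2norm \<pi> f" if "f \<in> L2 \<pi>" for f
    using C(2)[OF that] L2norm_nonneg[of \<pi> f] by (simp add: distrib_right del: L2norm_nonneg)
  then show thesis using that[of "C + 1"] C(1) by simp
qed

text \<open>A bounded operator sends the null function \<open>f - g\<close> to a null function, so
  it descends to classes modulo a.e. equality. Composition depends on this: the inner operator is
  linear only almost everywhere, and the outer one has to respect that.\<close>

lemma L2_bounded_op_cong_AE:
  assumes S: "L2_bounded_op \<pi> S" and "f \<in> L2 \<pi>" "g \<in> L2 \<pi>" "AE x in pi_measure \<pi>. f x = g x"
  shows "AE x in pi_measure \<pi>. S f x = S g x"
proof -
  obtain C where C: "\<And>f. f \<in> L2 \<pi> \<Longrightarrow> L2norm \<pi> (S f) \<le> C * L2norm \<pi> f"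
    using L2_bounded_opE[OF S] by blast
  have fg: "(\<lambda>x. f x - g x) \<in> L2 \<pi>" by (intro L2_diff assms)
  have "L2norm \<pi> (\<lambda>x. f x - g x) = 0"
    using L2norm_cong_AE[OF fg L2_zero] assms(4) by simp
  then have "L2norm \<pi> (S (\<lambda>x. f x - g x)) = 0"
    using C[OF fg] by (simp add: order_antisym)
  then have "AE x in pi_measure \<pi>. S (\<lambda>x. f x - g x) x = 0"
    by (intro L2norm_eq_0_imp_AE L2_bounded_op_in[OF S] fg)
  with L2_linear_op_diff[OF L2_bounded_op_linear[OF S] assms(2,3)] show ?thesis by auto
qed

text \<open>Agreement is demanded on L2 only, because the decomposition of \<open>mh_op\<close> is
  established only there.\<close>

lemma L2_bounded_op_cong:
  assumes "L2_bounded_op \<pi> S" "\<And>f. f \<in> L2 \<pi> \<Longrightarrow> S f = T f"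
  shows "L2_bounded_op \<pi> T"
  using assms unfolding L2_bounded_op_def L2_linear_op_def by (simp add: L2_lincomb)

lemma L2_bounded_op_id: "L2_bounded_op \<pi> (\<lambda>f. f)"
  unfolding L2_bounded_op_def L2_linear_op_def by (auto intro: exI[of _ 1])

lemma L2_linear_op_comp:
  assumes S: "L2_bounded_op \<pi> S" and T: "L2_linear_op \<pi> T"
  shows "L2_linear_op \<pi> (\<lambda>f. S (T f))"
  unfolding L2_linear_op_def
proof (intro conjI ballI allI)
  fix f assume f: "f \<in> L2 \<pi>"
  show "S (T f) \<in> L2 \<pi>"
    by (intro L2_bounded_op_in[OF S] L2_linear_op_in[OF T] f)
  fix g c assume g: "g \<in> L2 \<pi>"
  have "AE x in pi_measure \<pi>. S (T (\<lambda>y. c * f y + g y)) x = S (\<lambda>y. c * T f y + T g y) x"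
    by (intro L2_bounded_op_cong_AE[OF S] L2_lincomb L2_linear_op_in[OF T]
        L2_linear_op_lincomb[OF T] f g)
  moreover have "AE x in pi_measure \<pi>. S (\<lambda>y. c * T f y + T g y) x = c * S (T f) x + S (T g) x"
    by (intro L2_linear_op_lincomb L2_bounded_op_linear[OF S] L2_linear_op_in[OF T] f g)
  ultimately show "AE x in pi_measure \<pi>. S (T (\<lambda>y. c * f y + g y)) x = c * S (T f) x + S (T g) x"
    by eventually_elim simp
qed

lemma L2_bounded_op_comp:
  assumes S: "L2_bounded_op \<pi> S" and T: "L2_bounded_op \<pi> T"
  shows "L2_bounded_op \<pi> (\<lambda>f. S (T f))"
proof -
  obtain C where C: "C > 0" "\<And>f. f \<in> L2 \<pi> \<Longrightarrow> L2norm \<pi> (S f) \<le> C * L2norm \<pi> f"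
    using L2_bounded_opE[OF S] by blast
  obtain D where D: "D > 0" "\<And>f. f \<in> L2 \<pi> \<Longrightarrow> L2norm \<pi> (T f) \<le> D * L2norm \<pi> f"
    using L2_bounded_opE[OF T] by blast
  have "L2norm \<pi> (S (T f)) \<le> C * D * L2norm \<pi> f" if f: "f \<in> L2 \<pi>" for f
  proof -
    have "L2norm \<pi> (S (T f)) \<le> C * L2norm \<pi> (T f)"
      by (intro C L2_bounded_op_in[OF T] f)
    also have "\<dots> \<le> C * (D * L2norm \<pi> f)" using C(1) D(2)[OF f] by simp
    finally show ?thesis by (simp add: mult.assoc)
  qed
  then show ?thesis
    unfolding L2_bounded_op_def
    using L2_linear_op_comp[OF S L2_bounded_op_linear[OF T]] C(1) D(1)
    by (auto intro!: exI[of _ "C * D"])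
qed

lemma L2_bounded_op_lincomb:
  assumes S: "L2_bounded_op \<pi> S" and T: "L2_bounded_op \<pi> T"
  shows "L2_bounded_op \<pi> (\<lambda>f x. d * S f x + T f x)"
proof -
  obtain C where C: "C > 0" "\<And>f. f \<in> L2 \<pi> \<Longrightarrow> L2norm \<pi> (S f) \<le> C * L2norm \<pi> f"
    using L2_bounded_opE[OF S] by blast
  obtain D where D: "D > 0" "\<And>f. f \<in> L2 \<pi> \<Longrightarrow> L2norm \<pi> (T f) \<le> D * L2norm \<pi> f"
    using L2_bounded_opE[OF T] by blast
  have "L2norm \<pi> (\<lambda>x. d * S f x + T f x) \<le> (cmod d * C + D) * L2norm \<pi> f" if f: "f \<in> L2 \<pi>" for f
  proof -
    have "L2norm \<pi> (\<lambda>x. d * S f x + T f x) \<le> cmod d * L2norm \<pi> (S f) + L2norm \<pi> (T f)"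
      using L2norm_triangle[OF L2_cmult[OF L2_bounded_op_in[OF S f]] L2_bounded_op_in[OF T f]]
      by (simp add: L2norm_cmult)
    also have "\<dots> \<le> cmod d * (C * L2norm \<pi> f) + D * L2norm \<pi> f"
      by (intro add_mono mult_left_mono C D f) auto
    finally show ?thesis by (simp add: algebra_simps)
  qed
  then show ?thesis
    unfolding L2_bounded_op_def
    using L2_linear_op_lincomb_op[OF L2_bounded_op_linear[OF S] L2_bounded_op_linear[OF T]] C(1) D(1)
    by (auto intro!: exI[of _ "cmod d * C + D"])
qed

lemma L2_bounded_op_diff:
  "L2_bounded_op \<pi> S \<Longrightarrow> L2_bounded_op \<pi> T \<Longrightarrow> L2_bounded_op \<pi> (\<lambda>f x. S f x - T f x)"
  using L2_bounded_op_lincomb[of \<pi> T S "-1"] by simp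

lemma L2_bounded_op_add:
  "L2_bounded_op \<pi> S \<Longrightarrow> L2_bounded_op \<pi> T \<Longrightarrow> L2_bounded_op \<pi> (\<lambda>f x. S f x + T f x)"
  using L2_bounded_op_lincomb[of \<pi> S T 1] by simp

lemma L2_bounded_op_funpow: "L2_bounded_op \<pi> T \<Longrightarrow> L2_bounded_op \<pi> (T ^^ n)"
proof (induction n)
  case 0
  then show ?case using L2_bounded_op_id by (simp add: id_def)
next
  case (Suc n)
  then show ?case using L2_bounded_op_comp[of \<pi> T "T ^^ n"] by (simp add: comp_def)
qed

lemma L2_bounded_op_mult:
  assumes "h \<in> borel_measurable borel" "\<And>x. cmod (h x) \<le> C"
  shows "L2_bounded_op \<pi> (\<lambda>f x. h x * f x)"
proof -
  have C: "C \<ge> 0" using assms(2)[of 0] norm_ge_zero order_trans by blast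
  have "L2norm \<pi> (\<lambda>x. h x * f x) \<le> C * L2norm \<pi> f" if f: "f \<in> L2 \<pi>" for f
  proof -
    have "L2norm \<pi> (\<lambda>x. h x * f x) \<le> L2norm \<pi> (\<lambda>x. complex_of_real C * f x)"
      using assms(2) C
      by (intro L2norm_mono_AE L2_mult_bounded[OF f assms] L2_cmult f AE_I2)
        (auto simp: norm_mult intro: mult_right_mono)
    then show ?thesis using C by (simp add: L2norm_cmult)
  qed
  then show ?thesis
    unfolding L2_bounded_op_def L2_linear_op_def
    using C by (auto simp: distrib_left mult.left_commute intro: L2_mult_bounded[OF _ assms] exI[of _ C])
qed

lemma L2_bounded_op_indicator:
  "A \<in> sets borel \<Longrightarrow> L2_bounded_op \<pi> (\<lambda>f x. indicator A x * f x)"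
  by (rule L2_bounded_op_mult[where C = 1]) (auto simp: indicator_def)

section \<open>Compact operators: boundedness, compositions and sums\<close>

text \<open>If images of the unit ball were unbounded, some sequence would have image norms above
  \<open>n\<close>; this growth passes to every subsequence and contradicts the Cauchy property.
  Homogeneity then extends the bound from the unit ball to all of L2.\<close>

lemma L2_compact_op_bounded:
  assumes K: "L2_compact_op \<pi> K"
  shows "L2_bounded_op \<pi> K"
proof -
  have lin: "L2_linear_op \<pi> K" and pre: "L2_unit_precompact \<pi> K"
    using K by (auto simp: L2_compact_op_iff)
  have "\<exists>B. \<forall>f\<in>L2 \<pi>. L2norm \<pi> f \<le> 1 \<longrightarrow> L2norm \<pi> (K f) \<le> B"
  proof (rule ccontr)
    assume "\<not> ?thesis"
    then have "\<forall>n::nat. \<exists>f. f \<in> L2 \<pi> \<and> L2norm \<pi> f \<le> 1 \<and> L2norm \<pi> (K f) > real n"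
      by (metis not_less)
    then obtain fs where fs: "\<And>n::nat. fs n \<in> L2 \<pi>" "\<And>n. L2norm \<pi> (fs n) \<le> 1"
      "\<And>n. L2norm \<pi> (K (fs n)) > real n"
      by metis
    obtain \<phi> :: "nat \<Rightarrow> nat" where \<phi>: "strict_mono \<phi>"
      "\<And>e. e > 0 \<Longrightarrow> \<exists>N. \<forall>m\<ge>N. \<forall>n\<ge>N. L2norm \<pi> (\<lambda>x. K (fs (\<phi> m)) x - K (fs (\<phi> n)) x) < e"
      by (rule L2_unit_precompactD[of \<pi> K fs, OF pre fs(1,2)]) blast
    obtain N where N: "\<And>m n. m \<ge> N \<Longrightarrow> n \<ge> N \<Longrightarrow> L2norm \<pi> (\<lambda>x. K (fs (\<phi> m)) x - K (fs (\<phi> n)) x) < 1"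
      using \<phi>(2)[of 1] by auto
    obtain m :: nat where m: "m \<ge> N" "real m > 1 + L2norm \<pi> (K (fs (\<phi> N)))"
    proof -
      obtain k :: nat where "real k > 1 + L2norm \<pi> (K (fs (\<phi> N)))"
        using reals_Archimedean2 by blast
      then show thesis by (intro that[of "max k N"]) auto
    qed
    have "real m \<le> real (\<phi> m)" using strict_mono_imp_increasing[OF \<phi>(1)] by simp
    also have "\<dots> < L2norm \<pi> (K (fs (\<phi> m)))" by (rule fs)
    also have "\<dots> \<le> L2norm \<pi> (\<lambda>x. K (fs (\<phi> m)) x - K (fs (\<phi> N)) x) + L2norm \<pi> (K (fs (\<phi> N)))"
      using L2norm_triangle[of "\<lambda>x. K (fs (\<phi> m)) x - K (fs (\<phi> N)) x" \<pi> "K (fs (\<phi> N))"]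
      by (simp add: L2_diff L2_linear_op_in[OF lin] fs)
    also have "\<dots> < 1 + L2norm \<pi> (K (fs (\<phi> N)))" using N[OF m(1) order_refl] by simp
    finally show False using m(2) by simp
  qed
  then obtain B where B: "\<And>f. f \<in> L2 \<pi> \<Longrightarrow> L2norm \<pi> f \<le> 1 \<Longrightarrow> L2norm \<pi> (K f) \<le> B" by blast
  have B0: "B \<ge> 0" using order_trans[OF L2norm_nonneg B[OF L2_zero]] by simp
  have scale: "L2norm \<pi> (K (\<lambda>x. complex_of_real c * f x)) = c * L2norm \<pi> (K f)"
    if "f \<in> L2 \<pi>" "c > 0" for f c
  proof -
    have "L2norm \<pi> (K (\<lambda>x. complex_of_real c * f x)) = L2norm \<pi> (\<lambda>x. complex_of_real c * K f x)"
      by (intro L2norm_cong_AE L2_linear_op_in[OF lin] L2_cmult L2_linear_op_cmult[OF lin] that)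
    then show ?thesis unfolding L2norm_cmult using that(2) by simp
  qed
  have "L2norm \<pi> (K f) \<le> B * L2norm \<pi> f" if f: "f \<in> L2 \<pi>" for f
  proof (cases "L2norm \<pi> f = 0")
    case True
    have "L2norm \<pi> (K f) \<le> 0"
    proof (rule ccontr)
      assume "\<not> ?thesis"
      then have pos: "L2norm \<pi> (K f) > 0" by simp
      \<comment> \<open>A function of norm zero stays in the unit ball under every scaling, so a
        nonzero image could be scaled up to norm \<open>B + 1\<close>.\<close>
      define c where "c = (B + 1) / L2norm \<pi> (K f)"
      have "c > 0" using pos B0 by (simp add: c_def)
      have "L2norm \<pi> (K (\<lambda>x. complex_of_real c * f x)) \<le> B"
        by (rule B[OF L2_cmult[OF f]]) (use True in \<open>simp add: L2norm_cmult\<close>)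
      then show False using scale[OF f \<open>c > 0\<close>] pos by (simp add: c_def)
    qed
    then show ?thesis using True by simp
  next
    case False
    then have pos: "L2norm \<pi> f > 0" by (simp add: less_le)
    have "L2norm \<pi> (K (\<lambda>x. complex_of_real (1 / L2norm \<pi> f) * f x)) \<le> B"
      by (rule B[OF L2_cmult[OF f]]) (unfold L2norm_cmult, use pos in \<open>simp add: norm_divide\<close>)
    then have "1 / L2norm \<pi> f * L2norm \<pi> (K f) \<le> B"
      using scale[OF f, of "1 / L2norm \<pi> f"] pos by simp
    then show ?thesis using pos by (simp add: field_simps)
  qed
  then show ?thesis unfolding L2_bounded_op_def using lin B0 by blast
qed

lemma L2_compact_op_comp_left:
  assumes S: "L2_bounded_op \<pi> S" and K: "L2_compact_op \<pi> K"
  shows "L2_compact_op \<pi> (\<lambda>f. S (K f))"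
  unfolding L2_compact_op_iff
proof
  have lin: "L2_linear_op \<pi> K" and pre: "L2_unit_precompact \<pi> K"
    using K by (auto simp: L2_compact_op_iff)
  show "L2_linear_op \<pi> (\<lambda>f. S (K f))" by (rule L2_linear_op_comp[OF S lin])
  obtain C where C: "C > 0" "\<And>f. f \<in> L2 \<pi> \<Longrightarrow> L2norm \<pi> (S f) \<le> C * L2norm \<pi> f"
    using L2_bounded_opE[OF S] by blast
  show "L2_unit_precompact \<pi> (\<lambda>f. S (K f))"
    unfolding L2_unit_precompact_def
  proof (intro allI impI)
    fix fs :: "nat \<Rightarrow> real \<Rightarrow> complex"
    assume "\<forall>n. fs n \<in> L2 \<pi> \<and> L2norm \<pi> (fs n) \<le> 1"
    then have fs: "\<And>n. fs n \<in> L2 \<pi>" "\<And>n. L2norm \<pi> (fs n) \<le> 1" by auto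
    obtain \<phi> :: "nat \<Rightarrow> nat" where \<phi>: "strict_mono \<phi>"
      "\<And>e. e > 0 \<Longrightarrow> \<exists>N. \<forall>m\<ge>N. \<forall>n\<ge>N. L2norm \<pi> (\<lambda>x. K (fs (\<phi> m)) x - K (fs (\<phi> n)) x) < e"
      by (rule L2_unit_precompactD[of \<pi> K fs, OF pre fs(1,2)]) blast
    have le: "L2norm \<pi> (\<lambda>x. S (K (fs m)) x - S (K (fs n)) x)
        \<le> C * L2norm \<pi> (\<lambda>x. K (fs m) x - K (fs n) x)" for m n
    proof -
      have in2: "K (fs m) \<in> L2 \<pi>" "K (fs n) \<in> L2 \<pi>"
        by (intro L2_linear_op_in[OF lin] fs)+
      have "L2norm \<pi> (\<lambda>x. S (K (fs m)) x - S (K (fs n)) x) = L2norm \<pi> (S (\<lambda>x. K (fs m) x - K (fs n) x))"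
        using L2_linear_op_diff[OF L2_bounded_op_linear[OF S] in2]
        by (intro L2norm_cong_AE L2_diff L2_bounded_op_in[OF S] in2) auto
      also have "\<dots> \<le> C * L2norm \<pi> (\<lambda>x. K (fs m) x - K (fs n) x)"
        by (intro C L2_diff in2)
      finally show ?thesis .
    qed
    show "\<exists>\<phi>::nat \<Rightarrow> nat. strict_mono \<phi> \<and> (\<forall>e>0. \<exists>N. \<forall>m\<ge>N. \<forall>n\<ge>N.
        L2norm \<pi> (\<lambda>x. S (K (fs (\<phi> m))) x - S (K (fs (\<phi> n))) x) < e)"
    proof (intro exI[of _ \<phi>] conjI allI impI \<phi>(1))
      fix e :: real assume "e > 0"
      then obtain N where N: "\<And>m n. m \<ge> N \<Longrightarrow> n \<ge> N \<Longrightarrow>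
          L2norm \<pi> (\<lambda>x. K (fs (\<phi> m)) x - K (fs (\<phi> n)) x) < e / C"
        using \<phi>(2)[of "e / C"] C(1) by auto
      show "\<exists>N. \<forall>m\<ge>N. \<forall>n\<ge>N. L2norm \<pi> (\<lambda>x. S (K (fs (\<phi> m))) x - S (K (fs (\<phi> n))) x) < e"
      proof (intro exI[of _ N] allI impI)
        fix m n assume "m \<ge> N" "n \<ge> N"
        from N[OF this] have "C * L2norm \<pi> (\<lambda>x. K (fs (\<phi> m)) x - K (fs (\<phi> n)) x) < e"
          using C(1) by (simp add: field_simps)
        with le[of "\<phi> m" "\<phi> n"]
        show "L2norm \<pi> (\<lambda>x. S (K (fs (\<phi> m))) x - S (K (fs (\<phi> n))) x) < e" by linarith
      qed
    qed
  qed
qed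

lemma L2_compact_op_comp_right:
  assumes K: "L2_compact_op \<pi> K" and S: "L2_bounded_op \<pi> S"
  shows "L2_compact_op \<pi> (\<lambda>f. K (S f))"
  unfolding L2_compact_op_iff
proof
  have lin: "L2_linear_op \<pi> K" and pre: "L2_unit_precompact \<pi> K"
    using K by (auto simp: L2_compact_op_iff)
  show "L2_linear_op \<pi> (\<lambda>f. K (S f))"
    by (rule L2_linear_op_comp[OF L2_compact_op_bounded[OF K] L2_bounded_op_linear[OF S]])
  obtain C where C: "C > 0" "\<And>f. f \<in> L2 \<pi> \<Longrightarrow> L2norm \<pi> (S f) \<le> C * L2norm \<pi> f"
    using L2_bounded_opE[OF S] by blast
  show "L2_unit_precompact \<pi> (\<lambda>f. K (S f))"
    unfolding L2_unit_precompact_def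
  proof (intro allI impI)
    fix fs :: "nat \<Rightarrow> real \<Rightarrow> complex"
    assume "\<forall>n. fs n \<in> L2 \<pi> \<and> L2norm \<pi> (fs n) \<le> 1"
    then have fs: "\<And>n. fs n \<in> L2 \<pi>" "\<And>n. L2norm \<pi> (fs n) \<le> 1" by auto
    \<comment> \<open>Rescaling by the bound of \<open>S\<close> brings the inputs of
      \<open>K\<close> back into the unit ball; the factor \<open>C\<close> is restored in
      \<open>eq\<close>.\<close>
    define gs where "gs = (\<lambda>n x. complex_of_real (1 / C) * S (fs n) x)"
    have gs: "gs n \<in> L2 \<pi>" for n
      unfolding gs_def by (intro L2_cmult L2_bounded_op_in[OF S] fs)
    have gs1: "L2norm \<pi> (gs n) \<le> 1" for n
    proof -
      have "L2norm \<pi> (gs n) = 1 / C * L2norm \<pi> (S (fs n))"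
        unfolding gs_def L2norm_cmult using C(1) by (simp add: norm_divide)
      also have "\<dots> \<le> 1 / C * (C * 1)"
        using C fs by (intro mult_left_mono order_trans[OF C(2)] ) auto
      finally show ?thesis using C(1) by simp
    qed
    obtain \<phi> :: "nat \<Rightarrow> nat" where \<phi>: "strict_mono \<phi>"
      "\<And>e. e > 0 \<Longrightarrow> \<exists>N. \<forall>m\<ge>N. \<forall>n\<ge>N. L2norm \<pi> (\<lambda>x. K (gs (\<phi> m)) x - K (gs (\<phi> n)) x) < e"
      by (rule L2_unit_precompactD[of \<pi> K gs, OF pre gs gs1]) blast
    have Kgs: "AE x in pi_measure \<pi>. K (gs n) x = complex_of_real (1 / C) * K (S (fs n)) x" for n
      unfolding gs_def by (intro L2_linear_op_cmult[OF lin] L2_bounded_op_in[OF S] fs)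
    have eq: "L2norm \<pi> (\<lambda>x. K (S (fs m)) x - K (S (fs n)) x)
        = C * L2norm \<pi> (\<lambda>x. K (gs m) x - K (gs n) x)" for m n
    proof -
      have in2: "K (S (fs m)) \<in> L2 \<pi>" for m
        by (intro L2_linear_op_in[OF lin] L2_bounded_op_in[OF S] fs)
      have "L2norm \<pi> (\<lambda>x. K (gs m) x - K (gs n) x)
          = L2norm \<pi> (\<lambda>x. complex_of_real (1 / C) * (K (S (fs m)) x - K (S (fs n)) x))"
        using Kgs[of m] Kgs[of n]
        by (intro L2norm_cong_AE L2_diff L2_cmult in2 L2_linear_op_in[OF lin] gs)
          (auto simp: algebra_simps)
      also have "\<dots> = 1 / C * L2norm \<pi> (\<lambda>x. K (S (fs m)) x - K (S (fs n)) x)"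
        unfolding L2norm_cmult using C(1) by (simp add: norm_divide)
      finally show ?thesis using C(1) by simp
    qed
    show "\<exists>\<phi>::nat \<Rightarrow> nat. strict_mono \<phi> \<and> (\<forall>e>0. \<exists>N. \<forall>m\<ge>N. \<forall>n\<ge>N.
        L2norm \<pi> (\<lambda>x. K (S (fs (\<phi> m))) x - K (S (fs (\<phi> n))) x) < e)"
    proof (intro exI[of _ \<phi>] conjI allI impI \<phi>(1))
      fix e :: real assume "e > 0"
      then obtain N where "\<And>m n. m \<ge> N \<Longrightarrow> n \<ge> N \<Longrightarrow>
          L2norm \<pi> (\<lambda>x. K (gs (\<phi> m)) x - K (gs (\<phi> n)) x) < e / C"
        using \<phi>(2)[of "e / C"] C(1) by auto
      then show "\<exists>N. \<forall>m\<ge>N. \<forall>n\<ge>N. L2norm \<pi> (\<lambda>x. K (S (fs (\<phi> m))) x - K (S (fs (\<phi> n))) x) < e"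
        unfolding eq using C(1) by (intro exI[of _ N]) (simp add: field_simps)
    qed
  qed
qed

lemma L2_compact_op_add:
  assumes K: "L2_compact_op \<pi> K" and L: "L2_compact_op \<pi> L"
  shows "L2_compact_op \<pi> (\<lambda>f x. K f x + L f x)"
  unfolding L2_compact_op_iff
proof
  have linK: "L2_linear_op \<pi> K" and preK: "L2_unit_precompact \<pi> K"
    and linL: "L2_linear_op \<pi> L" and preL: "L2_unit_precompact \<pi> L"
    using K L by (auto simp: L2_compact_op_iff)
  show "L2_linear_op \<pi> (\<lambda>f x. K f x + L f x)"
    using L2_linear_op_lincomb_op[OF linK linL, of 1] by simp
  show "L2_unit_precompact \<pi> (\<lambda>f x. K f x + L f x)"
    unfolding L2_unit_precompact_def
  proof (intro allI impI)
    fix fs :: "nat \<Rightarrow> real \<Rightarrow> complex"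
    assume "\<forall>n. fs n \<in> L2 \<pi> \<and> L2norm \<pi> (fs n) \<le> 1"
    then have fs: "\<And>n. fs n \<in> L2 \<pi>" "\<And>n. L2norm \<pi> (fs n) \<le> 1" by auto
    obtain \<phi> :: "nat \<Rightarrow> nat" where \<phi>: "strict_mono \<phi>"
      "\<And>e. e > 0 \<Longrightarrow> \<exists>N. \<forall>m\<ge>N. \<forall>n\<ge>N. L2norm \<pi> (\<lambda>x. K (fs (\<phi> m)) x - K (fs (\<phi> n)) x) < e"
      by (rule L2_unit_precompactD[of \<pi> K fs, OF preK fs(1,2)]) blast
    obtain \<psi> :: "nat \<Rightarrow> nat" where \<psi>: "strict_mono \<psi>"
      "\<And>e. e > 0 \<Longrightarrow> \<exists>N. \<forall>m\<ge>N. \<forall>n\<ge>N. L2norm \<pi> (\<lambda>x. L (fs (\<phi> (\<psi> m))) x - L (fs (\<phi> (\<psi> n))) x) < e"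
      by (rule L2_unit_precompactD[of \<pi> L "\<lambda>n. fs (\<phi> n)", OF preL fs(1,2)]) blast
    have le: "L2norm \<pi> (\<lambda>x. K (fs m) x + L (fs m) x - (K (fs n) x + L (fs n) x))
      \<le> L2norm \<pi> (\<lambda>x. K (fs m) x - K (fs n) x) + L2norm \<pi> (\<lambda>x. L (fs m) x - L (fs n) x)" for m n
      using L2norm_triangle[OF L2_diff L2_diff,
          OF L2_linear_op_in[OF linK fs(1)] L2_linear_op_in[OF linK fs(1)]
             L2_linear_op_in[OF linL fs(1)] L2_linear_op_in[OF linL fs(1)], of m n m n]
      by (simp add: algebra_simps)
    show "\<exists>\<phi>::nat \<Rightarrow> nat. strict_mono \<phi> \<and> (\<forall>e>0. \<exists>N. \<forall>m\<ge>N. \<forall>n\<ge>N.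
        L2norm \<pi> (\<lambda>x. K (fs (\<phi> m)) x + L (fs (\<phi> m)) x - (K (fs (\<phi> n)) x + L (fs (\<phi> n)) x)) < e)"
    proof (intro exI[of _ "\<phi> \<circ> \<psi>"] conjI allI impI strict_mono_o \<phi>(1) \<psi>(1))
      fix e :: real assume e: "e > 0"
      obtain N1 where N1: "\<And>m n. m \<ge> N1 \<Longrightarrow> n \<ge> N1 \<Longrightarrow>
          L2norm \<pi> (\<lambda>x. K (fs (\<phi> m)) x - K (fs (\<phi> n)) x) < e / 2"
        using \<phi>(2)[of "e / 2"] e by auto
      obtain N2 where N2: "\<And>m n. m \<ge> N2 \<Longrightarrow> n \<ge> N2 \<Longrightarrow>
          L2norm \<pi> (\<lambda>x. L (fs (\<phi> (\<psi> m))) x - L (fs (\<phi> (\<psi> n))) x) < e / 2"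
        using \<psi>(2)[of "e / 2"] e by auto
      show "\<exists>N. \<forall>m\<ge>N. \<forall>n\<ge>N. L2norm \<pi> (\<lambda>x. K (fs ((\<phi> \<circ> \<psi>) m)) x + L (fs ((\<phi> \<circ> \<psi>) m)) x
          - (K (fs ((\<phi> \<circ> \<psi>) n)) x + L (fs ((\<phi> \<circ> \<psi>) n)) x)) < e"
      proof (intro exI[of _ "max N1 N2"] allI impI)
        fix m n assume mn: "m \<ge> max N1 N2" "n \<ge> max N1 N2"
        \<comment> \<open>Since \<open>\<psi>\<close> is increasing, \<open>\<psi> m\<close> is at
          least \<open>m\<close>, so the tail chosen for \<open>K\<close> still serves along the
          finer subsequence extracted for \<open>L\<close>.\<close>
        have "\<psi> m \<ge> N1" "\<psi> n \<ge> N1"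
          using mn strict_mono_imp_increasing[OF \<psi>(1), of m] strict_mono_imp_increasing[OF \<psi>(1), of n]
          by auto
        from N1[OF this] N2[of m n] mn le[of "\<phi> (\<psi> m)" "\<phi> (\<psi> n)"]
        show "L2norm \<pi> (\<lambda>x. K (fs ((\<phi> \<circ> \<psi>) m)) x + L (fs ((\<phi> \<circ> \<psi>) m)) x
          - (K (fs ((\<phi> \<circ> \<psi>) n)) x + L (fs ((\<phi> \<circ> \<psi>) n)) x)) < e"
          by simp
      qed
    qed
  qed
qed

text \<open>Provides the nonempty index set that the infimum over compact operators
  requires.\<close>

lemma L2_compact_op_zero: "L2_compact_op \<pi> (\<lambda>f x. 0)"
  unfolding L2_compact_op_def by (auto simp: L2_zero intro: exI[of _ id] strict_mono_id)

section \<open>The essential norms of the powers of an operator\<close>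

lemma L2_opnorm_bdd_above:
  assumes "L2_bounded_op \<pi> S"
  shows "bdd_above ((\<lambda>f. L2norm \<pi> (S f)) ` {f \<in> L2 \<pi>. L2norm \<pi> f \<le> 1})"
proof -
  obtain C where C: "C > 0" "\<And>f. f \<in> L2 \<pi> \<Longrightarrow> L2norm \<pi> (S f) \<le> C * L2norm \<pi> f"
    using L2_bounded_opE[OF assms] by blast
  have "L2norm \<pi> (S f) \<le> C" if "f \<in> L2 \<pi>" "L2norm \<pi> f \<le> 1" for f
    using C(2)[OF that(1)] mult_left_mono[OF that(2), of C] C(1) by linarith
  then show ?thesis by (auto intro!: bdd_aboveI2)
qed

lemma L2_opnorm_nonneg: "L2_bounded_op \<pi> S \<Longrightarrow> L2_opnorm \<pi> S \<ge> 0"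
  unfolding L2_opnorm_def
  by (rule cSUP_upper2[OF L2_opnorm_bdd_above, of _ _ "\<lambda>_. 0"]) (auto simp: L2_zero)

lemma L2norm_le_opnorm:
  assumes S: "L2_bounded_op \<pi> S" and f: "f \<in> L2 \<pi>"
  shows "L2norm \<pi> (S f) \<le> L2_opnorm \<pi> S * L2norm \<pi> f"
proof (cases "L2norm \<pi> f = 0")
  case True
  \<comment> \<open>Such an \<open>f\<close> cannot be normalised, but boundedness forces the image
    to have norm zero as well.\<close>
  then show ?thesis using L2_bounded_opE[OF S] f by (metis mult_zero_right)
next
  case False
  then have pos: "L2norm \<pi> f > 0" by (simp add: less_le)
  let ?c = "complex_of_real (1 / L2norm \<pi> f)"
  have cf: "(\<lambda>x. ?c * f x) \<in> L2 \<pi>" by (intro L2_cmult f)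
  have "L2norm \<pi> (\<lambda>x. ?c * f x) \<le> 1" unfolding L2norm_cmult using pos by (simp add: norm_divide)
  then have "L2norm \<pi> (S (\<lambda>x. ?c * f x)) \<le> L2_opnorm \<pi> S"
    unfolding L2_opnorm_def using cf by (intro cSUP_upper L2_opnorm_bdd_above S) auto
  also have "L2norm \<pi> (S (\<lambda>x. ?c * f x)) = L2norm \<pi> (\<lambda>x. ?c * S f x)"
    by (intro L2norm_cong_AE L2_bounded_op_in[OF S] cf f L2_cmult
        L2_linear_op_cmult[OF L2_bounded_op_linear[OF S]])
  finally show ?thesis unfolding L2norm_cmult using pos by (simp add: norm_divide field_simps)
qed

lemma L2_opnorm_le:
  assumes "C \<ge> 0" "\<And>f. f \<in> L2 \<pi> \<Longrightarrow> L2norm \<pi> (S f) \<le> C * L2norm \<pi> f"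
  shows "L2_opnorm \<pi> S \<le> C"
  unfolding L2_opnorm_def
proof (rule cSUP_least)
  show "{f \<in> L2 \<pi>. L2norm \<pi> f \<le> 1} \<noteq> {}" using L2_zero by (auto intro!: exI[of _ "\<lambda>_. 0"])
  fix f assume "f \<in> {f \<in> L2 \<pi>. L2norm \<pi> f \<le> 1}"
  then show "L2norm \<pi> (S f) \<le> C"
    using assms(2)[of f] mult_left_mono[of "L2norm \<pi> f" 1 C] assms(1) by auto
qed

text \<open>The quotient norm modulo compact operators, as in the Calkin algebra. Its value at
  \<open>T ^^ n\<close> is the infimum inside \<open>ess_spec_radius\<close>.\<close>

definition ess_norm :: "(real \<Rightarrow> real) \<Rightarrow> ((real \<Rightarrow> complex) \<Rightarrow> (real \<Rightarrow> complex)) \<Rightarrow> real" where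
  "ess_norm \<pi> S = (INF K\<in>{K. L2_compact_op \<pi> K}. L2_opnorm \<pi> (\<lambda>f x. S f x - K f x))"

lemma ess_norm_bdd_below:
  assumes "L2_bounded_op \<pi> S"
  shows "bdd_below ((\<lambda>K. L2_opnorm \<pi> (\<lambda>f x. S f x - K f x)) ` {K. L2_compact_op \<pi> K})"
  by (rule bdd_belowI2[where m = 0])
    (auto intro!: L2_opnorm_nonneg L2_bounded_op_diff assms intro: L2_compact_op_bounded)

lemma ess_norm_nonneg: "L2_bounded_op \<pi> S \<Longrightarrow> ess_norm \<pi> S \<ge> 0"
  unfolding ess_norm_def using L2_compact_op_zero
  by (intro cINF_greatest)
    (auto intro!: L2_opnorm_nonneg L2_bounded_op_diff intro: L2_compact_op_bounded)

lemma ess_norm_le: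
  "L2_bounded_op \<pi> S \<Longrightarrow> L2_compact_op \<pi> K \<Longrightarrow> ess_norm \<pi> S \<le> L2_opnorm \<pi> (\<lambda>f x. S f x - K f x)"
  unfolding ess_norm_def by (intro cINF_lower ess_norm_bdd_below) auto

lemma ess_norm_approx:
  assumes "L2_bounded_op \<pi> S" "e > 0"
  obtains K where "L2_compact_op \<pi> K" "L2_opnorm \<pi> (\<lambda>f x. S f x - K f x) < ess_norm \<pi> S + e"
proof -
  have "(INF K\<in>{K. L2_compact_op \<pi> K}. L2_opnorm \<pi> (\<lambda>f x. S f x - K f x)) < ess_norm \<pi> S + e"
    using assms(2) by (simp add: ess_norm_def)
  then show thesis
    using that L2_compact_op_zero
    by (subst (asm) cINF_less_iff) (auto intro!: ess_norm_bdd_below assms)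
qed

text \<open>Modulo compact operators, \<open>S T\<close> agrees with \<open>(S - K) (T - L)\<close>.\<close>

lemma ess_norm_comp_le:
  assumes S: "L2_bounded_op \<pi> S" and T: "L2_bounded_op \<pi> T"
  shows "ess_norm \<pi> (\<lambda>f. S (T f)) \<le> ess_norm \<pi> S * ess_norm \<pi> T"
proof -
  have "ess_norm \<pi> (\<lambda>f. S (T f)) \<le> (ess_norm \<pi> S + e) * (ess_norm \<pi> T + e)" if e: "e > 0" for e
  proof -
    obtain K where K: "L2_compact_op \<pi> K" "L2_opnorm \<pi> (\<lambda>f x. S f x - K f x) < ess_norm \<pi> S + e"
      by (rule ess_norm_approx[OF S e])
    obtain L where L: "L2_compact_op \<pi> L" "L2_opnorm \<pi> (\<lambda>f x. T f x - L f x) < ess_norm \<pi> T + e"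
      by (rule ess_norm_approx[OF T e])
    define S' T' where "S' = (\<lambda>f x. S f x - K f x)" and "T' = (\<lambda>f x. T f x - L f x)"
    have S': "L2_bounded_op \<pi> S'" and T': "L2_bounded_op \<pi> T'"
      unfolding S'_def T'_def
      by (intro L2_bounded_op_diff S T L2_compact_op_bounded K L)+
    \<comment> \<open>From \<open>S T - (S - K) (T - L) = S L + K (T - L)\<close>: in this
      arrangement each summand is a compact operator composed with a bounded one, and the identity
      uses the linearity of \<open>S\<close> alone.\<close>
    define Q where "Q = (\<lambda>f x. S (L f) x + K (T' f) x)"
    have Q: "L2_compact_op \<pi> Q"
      unfolding Q_def
      by (intro L2_compact_op_add L2_compact_op_comp_left[OF S L(1)]
          L2_compact_op_comp_right[OF K(1) T'])
    have ST: "L2_bounded_op \<pi> (\<lambda>f. S (T f))" by (rule L2_bounded_op_comp[OF S T])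
    have "L2_opnorm \<pi> (\<lambda>f x. S (T f) x - Q f x) \<le> L2_opnorm \<pi> S' * L2_opnorm \<pi> T'"
    proof (rule L2_opnorm_le)
      show "0 \<le> L2_opnorm \<pi> S' * L2_opnorm \<pi> T'"
        by (intro mult_nonneg_nonneg L2_opnorm_nonneg S' T')
      fix f assume f: "f \<in> L2 \<pi>"
      have Tf: "T f \<in> L2 \<pi>" and Lf: "L f \<in> L2 \<pi>" and T'f: "T' f \<in> L2 \<pi>"
        by (intro L2_bounded_op_in[OF T] L2_bounded_op_in[OF T']
            L2_bounded_op_in[OF L2_compact_op_bounded[OF L(1)]] f)+
      have "AE x in pi_measure \<pi>. S (T' f) x = S (T f) x - S (L f) x"
        unfolding T'_def by (intro L2_linear_op_diff L2_bounded_op_linear[OF S] Tf Lf)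
      then have "AE x in pi_measure \<pi>. S (T f) x - Q f x = S' (T' f) x"
        by eventually_elim (simp add: Q_def S'_def)
      then have "L2norm \<pi> (\<lambda>x. S (T f) x - Q f x) = L2norm \<pi> (S' (T' f))"
        by (intro L2norm_cong_AE L2_diff L2_bounded_op_in[OF ST] L2_bounded_op_in[OF S']
            L2_bounded_op_in[OF L2_compact_op_bounded[OF Q]] f T'f)
      also have "\<dots> \<le> L2_opnorm \<pi> S' * L2norm \<pi> (T' f)"
        by (rule L2norm_le_opnorm[OF S' T'f])
      also have "\<dots> \<le> L2_opnorm \<pi> S' * (L2_opnorm \<pi> T' * L2norm \<pi> f)"
        by (intro mult_left_mono L2norm_le_opnorm[OF T' f] L2_opnorm_nonneg S')
      finally show "L2norm \<pi> (\<lambda>x. S (T f) x - Q f x) \<le> L2_opnorm \<pi> S' * L2_opnorm \<pi> T' * L2norm \<pi> f"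
        by (simp add: mult.assoc)
    qed
    then have "ess_norm \<pi> (\<lambda>f. S (T f)) \<le> L2_opnorm \<pi> S' * L2_opnorm \<pi> T'"
      using ess_norm_le[OF ST Q] by simp
    also have "\<dots> \<le> (ess_norm \<pi> S + e) * (ess_norm \<pi> T + e)"
      using K(2) L(2) L2_opnorm_nonneg[OF S'] L2_opnorm_nonneg[OF T']
      unfolding S'_def[symmetric] T'_def[symmetric] by (intro mult_mono) auto
    finally show ?thesis .
  qed
  \<comment> \<open>The infima need not be attained, so the error \<open>e\<close> is removed by a
    limit from the right.\<close>
  then have "\<forall>\<^sub>F e in at_right 0. ess_norm \<pi> (\<lambda>f. S (T f)) \<le> (ess_norm \<pi> S + e) * (ess_norm \<pi> T + e)"
    by (auto simp: eventually_at_filter)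
  moreover have "((\<lambda>e. (ess_norm \<pi> S + e) * (ess_norm \<pi> T + e)) \<longlongrightarrow>
      (ess_norm \<pi> S + 0) * (ess_norm \<pi> T + 0)) (at_right 0)"
    by (intro tendsto_intros)
  ultimately show ?thesis
    using tendsto_lowerbound[of _ _ "at_right (0::real)"] by fastforce
qed

section \<open>Fekete's lemma and the limit of the roots\<close>

text \<open>The limit is the infimum of the roots: if the \<open>m\<close>-th root lies below
  \<open>c\<close>, division of \<open>n\<close> by \<open>m\<close> with remainder gives
  \<open>e n \<le> M * c ^ n\<close>. Working with roots instead of logarithms admits
  \<open>e n = 0\<close>.\<close>

lemma fekete_submultiplicative_root_convergent:
  fixes e :: "nat \<Rightarrow> real"
  assumes nonneg: "\<And>n. e n \<ge> 0" and submult: "\<And>m n. e (m + n) \<le> e m * e n"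
  shows "convergent (\<lambda>n. e n powr (1 / real n))"
proof -
  define u where "u = (\<lambda>n. e n powr (1 / real n))"
  \<comment> \<open>Index 0 is excluded because \<open>1 / real 0\<close> is 0, so
    \<open>u 0\<close> is not a root of \<open>e 0\<close>.\<close>
  define L where "L = (INF n\<in>{1..}. u n)"
  have bdd: "bdd_below (u ` {1..})" by (rule bdd_belowI2[where m = 0]) (simp add: u_def)
  have L0: "L \<ge> 0" unfolding L_def by (rule cINF_greatest) (auto simp: u_def)
  have "u \<longlonglongrightarrow> L"
  proof (rule order_tendstoI)
    fix y assume "y < L"
    moreover have "L \<le> u n" if "n \<ge> 1" for n
      unfolding L_def using that by (intro cINF_lower bdd) auto
    ultimately show "\<forall>\<^sub>F n in sequentially. y < u n"
      by (intro eventually_sequentiallyI[of 1]) (auto intro: less_le_trans)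
  next
    fix y assume y: "L < y"
    define c where "c = (L + y) / 2"
    have c: "L < c" "c < y" "c > 0" using y L0 by (auto simp: c_def)
    obtain m where m: "m \<ge> 1" "u m < c"
      using c(1) cINF_less_iff[OF _ bdd, of c] by (auto simp: L_def)
    have em: "e m \<le> c ^ m"
    proof -
      have "e m = u m powr real m"
        using m(1) nonneg[of m] by (simp add: u_def powr_powr)
      also have "\<dots> \<le> c powr real m" using m(2) by (intro powr_mono2) (auto simp: u_def)
      finally show ?thesis using c(3) by (simp add: powr_realpow)
    qed
    \<comment> \<open>Bounds all remainders \<open>j < m\<close> at once, relative to
      \<open>c ^ j\<close>. The added 1 keeps \<open>M\<close> positive, so that its
      \<open>n\<close>-th root tends to 1.\<close>
    define M where "M = (\<Sum>j<m. e j / c ^ j) + 1"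
    have M: "M > 0" unfolding M_def using c(3) nonneg by (intro add_nonneg_pos sum_nonneg) auto
    have ind: "e (m * k + j) \<le> (c ^ m) ^ k * e j" for k j
    proof (induction k)
      case (Suc k)
      have "e (m * Suc k + j) \<le> e m * e (m * k + j)"
        using submult[of m "m * k + j"] by (simp add: algebra_simps)
      also have "\<dots> \<le> c ^ m * ((c ^ m) ^ k * e j)"
        using c(3) by (intro mult_mono em Suc nonneg) auto
      finally show ?case by (simp add: mult.assoc)
    qed simp
    have bound: "e n \<le> M * c ^ n" for n
    proof -
      have "e n \<le> (c ^ m) ^ (n div m) * e (n mod m)"
        using ind[of "n div m" "n mod m"] by simp
      also have "\<dots> \<le> (c ^ m) ^ (n div m) * (M * c ^ (n mod m))"
      proof (intro mult_left_mono)
        have "e (n mod m) / c ^ (n mod m) \<le> (\<Sum>j<m. e j / c ^ j)"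
          using m(1) c(3) nonneg by (intro member_le_sum) auto
        also have "\<dots> \<le> M" by (simp add: M_def)
        finally show "e (n mod m) \<le> M * c ^ (n mod m)" using c(3) by (simp add: field_simps)
      qed (use c(3) in auto)
      also have "\<dots> = M * c ^ (m * (n div m) + n mod m)"
        unfolding power_add power_mult by simp
      finally show ?thesis by simp
    qed
    have "(\<lambda>n. M powr (1 / real n) * c) \<longlonglongrightarrow> M powr 0 * c"
      using M by (intro tendsto_intros lim_1_over_n) auto
    then have "\<forall>\<^sub>F n in sequentially. M powr (1 / real n) * c < y"
      using M c(2) by (intro order_tendstoD(2)) auto
    then show "\<forall>\<^sub>F n in sequentially. u n < y"
      using eventually_ge_at_top[of "1::nat"]
    proof eventually_elim
      case (elim n)
      have "u n \<le> (M * c ^ n) powr (1 / real n)"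
        unfolding u_def by (intro powr_mono2 bound nonneg) auto
      also have "\<dots> = M powr (1 / real n) * c"
        using M c(3) elim(2) by (simp add: powr_mult powr_realpow[symmetric] powr_powr)
      finally show ?case using elim(1) by simp
    qed
  qed
  then show ?thesis unfolding u_def convergent_def by blast
qed

lemma ess_spec_radius_le_ess_norm:
  assumes T: "L2_bounded_op \<pi> T"
  shows "ess_spec_radius \<pi> T \<le> ess_norm \<pi> T"
proof -
  define e where "e n = ess_norm \<pi> (T ^^ n)" for n
  have nonneg: "e n \<ge> 0" for n
    unfolding e_def by (intro ess_norm_nonneg L2_bounded_op_funpow T)
  have submult: "e (m + n) \<le> e m * e n" for m n
    using ess_norm_comp_le[OF L2_bounded_op_funpow[OF T] L2_bounded_op_funpow[OF T], of m n]
    by (simp add: e_def funpow_add comp_def)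
  \<comment> \<open>The powers start at exponent 1, so the essential norm \<open>e 0\<close> of the
    identity does not enter.\<close>
  have pow: "e (Suc n) \<le> e 1 ^ Suc n" for n
  proof (induction n)
    case (Suc n)
    have "e (Suc (Suc n)) \<le> e 1 * e (Suc n)" using submult[of 1 "Suc n"] by simp
    also have "\<dots> \<le> e 1 * e 1 ^ Suc n" by (intro mult_left_mono Suc nonneg)
    finally show ?case by simp
  qed simp
  have le: "e n powr (1 / real n) \<le> e 1" if n: "n \<ge> 1" for n
  proof -
    have "e n powr (1 / real n) \<le> (e 1 ^ n) powr (1 / real n)"
      using pow[of "n - 1"] n by (intro powr_mono2 nonneg) auto
    also have "\<dots> = e 1"
      using n nonneg[of 1] by (cases "e 1 = 0") (auto simp: powr_realpow[symmetric] powr_powr)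
    finally show ?thesis .
  qed
  \<comment> \<open>Bounds on the terms carry over to \<open>lim\<close> only once convergence is
    known.\<close>
  have "(\<lambda>n. e n powr (1 / real n)) \<longlonglongrightarrow> lim (\<lambda>n. e n powr (1 / real n))"
    using fekete_submultiplicative_root_convergent[of e] nonneg submult by (simp add: convergent_LIMSEQ_iff)
  then have "lim (\<lambda>n. e n powr (1 / real n)) \<le> e 1"
    using le by (intro LIMSEQ_le_const2) auto
  then show ?thesis by (simp add: ess_spec_radius_def e_def ess_norm_def)
qed

section \<open>A weighted Cauchy--Schwarz inequality for nonnegative integrals\<close>

text \<open>Expanding \<open>(x - y)\<^sup>2\<close> makes no sense in \<open>ennreal\<close>, so
  infinite arguments, for which the right-hand side is infinite, are split off and the rest is read
  in the reals.\<close>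

lemma two_mult_le_squares_ennreal: "2 * (x * y) \<le> x * x + y * (y :: ennreal)"
proof (cases "x = \<infinity> \<or> y = \<infinity>")
  case True
  then show ?thesis by (auto simp: ennreal_top_mult)
next
  case False
  then obtain u v where u: "x = ennreal u" "u \<ge> 0" and v: "y = ennreal v" "v \<ge> 0"
    by (metis ennreal_cases infinity_ennreal_def)
  have "2 * (u * v) \<le> u * u + v * v"
    using sum_squares_bound[of u v] by (simp add: power2_eq_square mult.assoc)
  then have "ennreal (2 * (u * v)) \<le> ennreal (u * u + v * v)" by (rule ennreal_leI)
  then show ?thesis using u v by (simp add: ennreal_mult ennreal_plus)
qed

text \<open>Writing the square as a double integral and using \<open>2 g(u) g(v) \<le> g(u)\<^sup>2 + g(v)\<^sup>2\<close>
  avoids the division by the total mass in the usual Cauchy--Schwarz argument.\<close>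

lemma nn_integral_weighted_square_le:
  assumes [measurable]: "k \<in> borel_measurable M" "g \<in> borel_measurable M"
  shows "(\<integral>\<^sup>+u. k u * g u \<partial>M) * (\<integral>\<^sup>+u. k u * g u \<partial>M) \<le> (\<integral>\<^sup>+u. k u \<partial>M) * (\<integral>\<^sup>+u. k u * (g u * g u) \<partial>M)"
proof -
  let ?W = "\<integral>\<^sup>+u. k u * g u \<partial>M" and ?B = "\<integral>\<^sup>+u. k u \<partial>M" and ?Q = "\<integral>\<^sup>+u. k u * (g u * g u) \<partial>M"
  have "2 * (?W * ?W) = (\<integral>\<^sup>+u. \<integral>\<^sup>+v. k u * k v * (2 * (g u * g v)) \<partial>M \<partial>M)"
  proof -
    have "(\<integral>\<^sup>+v. k u * k v * (2 * (g u * g v)) \<partial>M) = 2 * ?W * (k u * g u)" for u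
    proof -
      have "(\<integral>\<^sup>+v. k u * k v * (2 * (g u * g v)) \<partial>M) = (\<integral>\<^sup>+v. (2 * (k u * g u)) * (k v * g v) \<partial>M)"
        by (intro nn_integral_cong) (simp add: ac_simps)
      also have "\<dots> = 2 * (k u * g u) * ?W" by (rule nn_integral_cmult) measurable
      finally show ?thesis by (simp add: ac_simps)
    qed
    then show ?thesis by (simp add: nn_integral_cmult mult.assoc)
  qed
  also have "\<dots> \<le> (\<integral>\<^sup>+u. \<integral>\<^sup>+v. k u * k v * (g u * g u + g v * g v) \<partial>M \<partial>M)"
    by (intro nn_integral_mono mult_left_mono two_mult_le_squares_ennreal) simp
  also have "\<dots> = (\<integral>\<^sup>+u. ?B * (k u * (g u * g u)) + ?Q * k u \<partial>M)"
  proof (rule nn_integral_cong)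
    fix u
    have "(\<integral>\<^sup>+v. k u * k v * (g u * g u + g v * g v) \<partial>M)
        = (\<integral>\<^sup>+v. (k u * (g u * g u)) * k v + k u * (k v * (g v * g v)) \<partial>M)"
      by (intro nn_integral_cong) (simp add: distrib_left ac_simps)
    also have "\<dots> = (\<integral>\<^sup>+v. (k u * (g u * g u)) * k v \<partial>M) + (\<integral>\<^sup>+v. k u * (k v * (g v * g v)) \<partial>M)"
      by (rule nn_integral_add) measurable
    also have "\<dots> = (k u * (g u * g u)) * ?B + k u * ?Q"
      by (simp add: nn_integral_cmult)
    finally show "(\<integral>\<^sup>+v. k u * k v * (g u * g u + g v * g v) \<partial>M) = ?B * (k u * (g u * g u)) + ?Q * k u"
      by (simp add: mult.commute)
  qed
  also have "\<dots> = ?B * ?Q + ?Q * ?B"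
    by (simp add: nn_integral_add nn_integral_cmult)
  also have "\<dots> = 2 * (?B * ?Q)" by (simp add: mult.commute mult_2)
  finally show ?thesis by (simp add: ennreal_mult_le_mult_iff)
qed

section \<open>The Metropolis--Hastings operator\<close>

locale metropolis_hastings =
  fixes \<pi> :: "real \<Rightarrow> real" and q :: "real \<Rightarrow> real \<Rightarrow> real" and s :: real
  assumes pi_pos: "\<And>x. \<pi> x > 0"
    and pi_cont: "continuous_on UNIV \<pi>"
    and pi_int: "integrable lborel \<pi>"
    and pi_one: "(\<integral>x. \<pi> x \<partial>lborel) = 1"
    and q_nonneg: "\<And>x y. q x y \<ge> 0"
    and q_bdd: "\<exists>B. \<forall>x y. q x y \<le> B"
    and q_cont: "continuous_on UNIV (\<lambda>(x, y). q x y)"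
    and q_int: "\<And>x. integrable lborel (q x)"
    and q_one: "\<And>x. (\<integral>y. q x y \<partial>lborel) = 1"
    and s_pos: "s > 0"
    and q_supp: "\<And>x u. \<bar>u\<bar> > s \<Longrightarrow> q x (x + u) = 0"
begin

abbreviation t where "t \<equiv> mh_t \<pi> q"
abbreviation r where "r \<equiv> mh_r \<pi> q"

text \<open>The integral part of \<open>mh_op\<close>, without the holding term
  \<open>r x * f x\<close>.\<close>

definition T :: "(real \<Rightarrow> complex) \<Rightarrow> real \<Rightarrow> complex" where
  "T f x = (\<integral>y. f y * complex_of_real (t x y) \<partial>lborel)"

lemma pi_measurable [measurable]: "\<pi> \<in> borel_measurable borel"
  using pi_cont by (rule borel_measurable_continuous_onI)

lemma t_nonneg [simp]: "t x y \<ge> 0"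
  using q_nonneg pi_pos by (simp add: mh_t_def less_imp_le)

lemma t_le_q: "t x y \<le> q x y"
  by (simp add: mh_t_def)

lemma t_eq_0: "\<bar>x - y\<bar> > s \<Longrightarrow> t x y = 0"
  using q_supp[of "y - x" x] t_le_q[of x y] t_nonneg[of x y] by (simp add: abs_minus_commute)

lemma t_continuous: "continuous_on UNIV (\<lambda>z. t (fst z) (snd z))"
proof -
  have q: "continuous_on UNIV (\<lambda>z. q (fst z) (snd z))"
    using q_cont by (simp add: case_prod_unfold)
  have "continuous_on UNIV (\<lambda>z::real \<times> real. (snd z, fst z))" by (intro continuous_intros)
  from continuous_on_compose2[OF q this]
  have q': "continuous_on UNIV (\<lambda>z. q (snd z) (fst z))" by simp
  have p: "continuous_on UNIV (\<lambda>z::real \<times> real. \<pi> (fst z))" "continuous_on UNIV (\<lambda>z::real \<times> real. \<pi> (snd z))"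
    by (auto intro!: continuous_on_compose2[OF pi_cont] continuous_intros)
  show ?thesis
    unfolding mh_t_def using pi_pos
    by (intro continuous_intros q q' p) (auto simp: less_imp_neq[symmetric])
qed

lemma continuous_on_t:
  "continuous_on S f \<Longrightarrow> continuous_on S g \<Longrightarrow> continuous_on S (\<lambda>x. t (f x) (g x))"
  using continuous_on_compose2[OF t_continuous, of S "\<lambda>x. (f x, g x)"]
  by (auto intro: continuous_on_Pair)

lemma t_measurable [measurable (raw)]:
  assumes [measurable]: "f \<in> borel_measurable M" "g \<in> borel_measurable M"
  shows "(\<lambda>x. t (f x) (g x)) \<in> borel_measurable M"
proof -
  have [measurable]: "(\<lambda>z. t (fst z) (snd z)) \<in> borel_measurable borel"
    by (rule borel_measurable_continuous_onI[OF t_continuous])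
  have "(\<lambda>x. (\<lambda>z. t (fst z) (snd z)) (f x, g x)) \<in> borel_measurable M"
    by measurable
  then show ?thesis by simp
qed

lemma t_boundedE:
  obtains B where "B > 0" "\<And>x y. t x y \<le> B"
proof -
  obtain B where B: "\<And>x y. q x y \<le> B" using q_bdd by blast
  have "t x y \<le> max B 1" for x y using t_le_q[of x y] B[of x y] by simp
  then show thesis using that[of "max B 1"] by simp
qed

lemma t_integrable: "integrable lborel (t x)"
  by (rule Bochner_Integration.integrable_bound[OF q_int[of x]]) (auto simp: t_le_q q_nonneg)

lemma r_nonneg: "r x \<ge> 0"
  using integral_mono[OF t_integrable q_int, of x x] t_le_q q_one[of x] by (simp add: mh_r_def)

lemma r_le_1: "r x \<le> 1"
  by (simp add: mh_r_def)

lemma r_measurable [measurable]: "r \<in> borel_measurable borel"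
proof -
  have "(\<lambda>x. 1 - (\<integral>y. t x y \<partial>lborel)) \<in> borel_measurable borel"
    by measurable
  then show ?thesis by (simp add: mh_r_def[abs_def])
qed

text \<open>Detailed balance \<open>\<pi>(x) t(x,y) = \<pi>(y) t(y,x)\<close>, in symmetrised form.\<close>

lemma t_mult_sqrt: "t x y * sqrt (\<pi> x) = sqrt (t x y * t y x) * sqrt (\<pi> y)"
proof -
  \<comment> \<open>Multiplied by \<open>\<pi> x\<close>, the kernel becomes a minimum of two terms
    that are exchanged when \<open>x\<close> and \<open>y\<close> are swapped.\<close>
  have min: "\<pi> x * t x y = min (\<pi> x * q x y) (\<pi> y * q y x)" for x y
    using pi_pos[of x] by (simp add: mh_t_def min_mult_distrib_left)
  have bal: "\<pi> x * t x y = \<pi> y * t y x"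
    unfolding min by (simp add: min.commute)
  have "sqrt (t x y * t y x) * sqrt (\<pi> y) = sqrt (t x y * (\<pi> y * t y x))"
    by (simp add: real_sqrt_mult)
  also have "\<dots> = sqrt ((t x y)\<^sup>2 * \<pi> x)"
    by (simp add: bal[symmetric] power2_eq_square)
  also have "\<dots> = t x y * sqrt (\<pi> x)" by (simp add: real_sqrt_mult)
  finally show ?thesis by simp
qed

lemma integrable_pi_measure_iff:
  fixes g :: "real \<Rightarrow> real"
  assumes "g \<in> borel_measurable borel"
  shows "integrable (pi_measure \<pi>) g \<longleftrightarrow> integrable lborel (\<lambda>x. \<pi> x * g x)"
  unfolding pi_measure_def using assms pi_pos
  by (subst integrable_density) (auto simp: less_imp_le)

lemma integral_pi_measure:
  fixes g :: "real \<Rightarrow> real"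
  assumes "g \<in> borel_measurable borel"
  shows "(\<integral>x. g x \<partial>pi_measure \<pi>) = (\<integral>x. \<pi> x * g x \<partial>lborel)"
  unfolding pi_measure_def using assms pi_pos
  by (subst integral_density) (auto simp: less_imp_le)

lemma integrable_pi_measure_const: "integrable (pi_measure \<pi>) (\<lambda>x. c :: real)"
  using pi_int by (subst integrable_pi_measure_iff) auto

section \<open>Compactness of the integral operator on bounded windows\<close>

text \<open>On a compact interval \<open>\<pi>\<close> has a positive lower bound \<open>m\<close>,
  and \<open>cmod (f y)\<close> is at most \<open>1 + (cmod (f y))\<^sup>2\<close>, whose integral
  against \<open>\<pi>\<close> is at most 2 on the unit ball; hence \<open>C = 2 / m\<close>. The
  constant is chosen before \<open>f\<close>, as equicontinuity of a whole sequence
  requires.\<close>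

lemma L2_locally_integrable:
  obtains C where "C > 0"
    "\<And>f. f \<in> L2 \<pi> \<Longrightarrow> integrable lborel (\<lambda>y. indicator {-\<rho>..\<rho>} y * cmod (f y))"
    "\<And>f. f \<in> L2 \<pi> \<Longrightarrow> L2norm \<pi> f \<le> 1 \<Longrightarrow> (\<integral>y. indicator {-\<rho>..\<rho>} y * cmod (f y) \<partial>lborel) \<le> C"
proof -
  have "\<exists>m>0. \<forall>y\<in>{-\<rho>..\<rho>}. m \<le> \<pi> y"
  proof (cases "{-\<rho>..\<rho>} = {}")
    case False
    then show ?thesis
      using continuous_attains_inf[OF compact_Icc False continuous_on_subset[OF pi_cont]] pi_pos
      by blast
  qed (auto intro: exI[of _ 1])
  then obtain m where m: "m > 0" "\<And>y. y \<in> {-\<rho>..\<rho>} \<Longrightarrow> m \<le> \<pi> y" by blast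
  have main: "integrable lborel (\<lambda>y. indicator {-\<rho>..\<rho>} y * cmod (f y)) \<and>
      (\<integral>y. indicator {-\<rho>..\<rho>} y * cmod (f y) \<partial>lborel) \<le> 1 / m * (1 + (L2norm \<pi> f)\<^sup>2)"
    if f: "f \<in> L2 \<pi>" for f
  proof -
    have [measurable]: "f \<in> borel_measurable borel" by (rule L2_measurable[OF f])
    have int: "integrable (pi_measure \<pi>) (\<lambda>x. 1 + (cmod (f x))\<^sup>2)"
      using integrable_pi_measure_const[of 1] L2_integrable[OF f] by simp
    then have int': "integrable lborel (\<lambda>x. 1 / m * (\<pi> x * (1 + (cmod (f x))\<^sup>2)))"
      by (intro integrable_mult_right) (subst (asm) integrable_pi_measure_iff, auto)
    have le: "indicator {-\<rho>..\<rho>} y * cmod (f y) \<le> 1 / m * (\<pi> y * (1 + (cmod (f y))\<^sup>2))" for y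
    proof (cases "y \<in> {-\<rho>..\<rho>}")
      case True
      have "cmod (f y) \<le> 1 + (cmod (f y))\<^sup>2"
        using sum_squares_bound[of 1 "cmod (f y)"] norm_ge_zero[of "f y"]
        by (simp del: norm_ge_zero)
      then have "m * cmod (f y) \<le> \<pi> y * (1 + (cmod (f y))\<^sup>2)"
        using m True pi_pos[of y] by (intro mult_mono) auto
      then show ?thesis using True m(1) by (simp add: field_simps)
    next
      case False
      then show ?thesis using m(1) pi_pos[of y] by simp
    qed
    have int_ind: "integrable lborel (\<lambda>y. indicator {-\<rho>..\<rho>} y * cmod (f y))"
      by (rule Bochner_Integration.integrable_bound[OF int'])
        (measurable, rule AE_I2, rule order_trans[OF _ order_trans[OF le abs_ge_self, folded real_norm_def]], simp)
    have "(\<integral>y. indicator {-\<rho>..\<rho>} y * cmod (f y) \<partial>lborel) \<le> (\<integral>x. 1 / m * (\<pi> x * (1 + (cmod (f x))\<^sup>2)) \<partial>lborel)"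
      by (intro integral_mono int_ind int' le)
    also have "\<dots> = 1 / m * (\<integral>x. 1 + (cmod (f x))\<^sup>2 \<partial>pi_measure \<pi>)"
      by (subst integral_pi_measure) auto
    also have "(\<integral>x. 1 + (cmod (f x))\<^sup>2 \<partial>pi_measure \<pi>) = (\<integral>x. 1 \<partial>pi_measure \<pi>) + (L2norm \<pi> f)\<^sup>2"
      unfolding L2norm_power2
      by (rule Bochner_Integration.integral_add[OF integrable_pi_measure_const L2_integrable[OF f]])
    also have "(\<integral>x. 1 \<partial>pi_measure \<pi>) = (1 :: real)"
      by (subst integral_pi_measure) (auto simp: pi_one)
    finally show ?thesis using int_ind by simp
  qed
  show thesis
  proof (rule that[of "1 / m * 2"])
    fix f assume f: "f \<in> L2 \<pi>" "L2norm \<pi> f \<le> 1"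
    have "(\<integral>y. indicator {-\<rho>..\<rho>} y * cmod (f y) \<partial>lborel) \<le> 1 / m * (1 + (L2norm \<pi> f)\<^sup>2)"
      using main[OF f(1)] by blast
    also have "\<dots> \<le> 1 / m * 2"
      using f(2) m(1) by (intro mult_left_mono) (auto simp: power_le_one)
    finally show "(\<integral>y. indicator {-\<rho>..\<rho>} y * cmod (f y) \<partial>lborel) \<le> 1 / m * 2" .
  qed (use m(1) main in auto)
qed

lemma L2_integrable_on_Icc:
  "f \<in> L2 \<pi> \<Longrightarrow> integrable lborel (\<lambda>y. indicator {-\<rho>..\<rho>} y * cmod (f y))"
  by (rule L2_locally_integrable[of \<rho>]) blast

lemma T_integrand_integrable:
  assumes f: "f \<in> L2 \<pi>"
  shows "integrable lborel (\<lambda>y. f y * complex_of_real (t x y))"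
proof -
  obtain B where B: "B > 0" "\<And>x y. t x y \<le> B" by (rule t_boundedE) blast
  have [measurable]: "f \<in> borel_measurable borel" by (rule L2_measurable[OF f])
  \<comment> \<open>The kernel \<open>t x\<close> vanishes at distance more than \<open>s\<close>
    from \<open>x\<close>, hence outside this interval.\<close>
  let ?\<rho> = "\<bar>x\<bar> + s"
  have "integrable lborel (\<lambda>y. B * (indicator {-?\<rho>..?\<rho>} y * cmod (f y)))"
    by (intro integrable_mult_right L2_integrable_on_Icc f)
  then show ?thesis
  proof (rule Bochner_Integration.integrable_bound)
    show "AE y in lborel. norm (f y * complex_of_real (t x y)) \<le> norm (B * (indicator {-?\<rho>..?\<rho>} y * cmod (f y)))"
    proof (rule AE_I2)
      fix y
      show "norm (f y * complex_of_real (t x y)) \<le> norm (B * (indicator {-?\<rho>..?\<rho>} y * cmod (f y)))"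
      proof (cases "y \<in> {-?\<rho>..?\<rho>}")
        case True
        then show ?thesis
          using B mult_left_mono[OF B(2)[of x y] norm_ge_zero[of "f y"]] by (simp add: norm_mult mult.commute)
      next
        case False
        then have "t x y = 0" by (intro t_eq_0) auto
        then show ?thesis by simp
      qed
    qed
  qed measurable
qed

lemma T_lincomb:
  assumes "f \<in> L2 \<pi>" "g \<in> L2 \<pi>"
  shows "T (\<lambda>y. c * f y + g y) x = c * T f x + T g x"
proof -
  have "T (\<lambda>y. c * f y + g y) x
      = (\<integral>y. c * (f y * complex_of_real (t x y)) + g y * complex_of_real (t x y) \<partial>lborel)"
    unfolding T_def by (simp add: algebra_simps)
  also have "\<dots> = c * T f x + T g x"
    unfolding T_def using assms[THEN T_integrand_integrable, of x] by simp
  finally show ?thesis .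
qed

lemma T_measurable [measurable]:
  assumes [measurable]: "f \<in> borel_measurable borel"
  shows "T f \<in> borel_measurable borel"
proof -
  have "(\<lambda>x. \<integral>y. f y * complex_of_real (t x y) \<partial>lborel) \<in> borel_measurable borel"
    by measurable
  then show ?thesis by (simp add: T_def[abs_def])
qed

text \<open>One estimate for two uses: \<open>k = 0\<close> gives uniform bounds for
  \<open>T f\<close>, and \<open>k = t x'\<close> with another point \<open>x'\<close> of the window
  gives its modulus of continuity. For \<open>|x| \<le> R\<close> the kernel lives in the window of
  radius \<open>R + s\<close>.\<close>

lemma T_bound:
  assumes f: "f \<in> L2 \<pi>" and "\<bar>x\<bar> \<le> R" and d: "\<And>y. y \<in> {-(R + s)..R + s} \<Longrightarrow> \<bar>t x y - k y\<bar> \<le> d"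
    and k: "\<And>y. y \<notin> {-(R + s)..R + s} \<Longrightarrow> k y = 0"
    and int: "integrable lborel (\<lambda>y. f y * complex_of_real (k y))"
  shows "cmod (T f x - (\<integral>y. f y * complex_of_real (k y) \<partial>lborel))
    \<le> d * (\<integral>y. indicator {-(R + s)..R + s} y * cmod (f y) \<partial>lborel)"
proof -
  have "T f x - (\<integral>y. f y * complex_of_real (k y) \<partial>lborel) = (\<integral>y. f y * complex_of_real (t x y - k y) \<partial>lborel)"
    unfolding T_def using T_integrand_integrable[OF f, of x] int by (simp add: algebra_simps)
  also have "cmod \<dots> \<le> (\<integral>y. d * (indicator {-(R + s)..R + s} y * cmod (f y)) \<partial>lborel)"
  proof (rule order_trans[OF integral_norm_bound integral_mono])
    show "integrable lborel (\<lambda>y. cmod (f y * complex_of_real (t x y - k y)))"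
      using integrable_norm[OF Bochner_Integration.integrable_diff[OF T_integrand_integrable[OF f, of x] int]]
      by (simp add: algebra_simps)
    show "integrable lborel (\<lambda>y. d * (indicator {-(R + s)..R + s} y * cmod (f y)))"
      by (intro integrable_mult_right L2_integrable_on_Icc f)
    fix y
    show "norm (f y * complex_of_real (t x y - k y)) \<le> d * (indicator {-(R + s)..R + s} y * cmod (f y))"
    proof (cases "y \<in> {-(R + s)..R + s}")
      case True
      then show ?thesis
        using mult_left_mono[OF d[OF True] norm_ge_zero[of "f y"]]
        by (simp add: norm_mult mult.commute del: of_real_diff)
    next
      case False
      then have "t x y = 0" using assms(2) by (intro t_eq_0) auto
      then show ?thesis using False k by simp
    qed
  qed
  finally show ?thesis by simp
qed

text \<open>Only the L1 norm of \<open>f\<close> on the window enters the bounds, so they are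
  uniform over the unit ball. The uniform convergence supplied by Arzela--Ascoli turns into L2
  convergence because \<open>\<pi>\<close> has total mass 1.\<close>

lemma L2_compact_op_cutoff_T:
  "L2_compact_op \<pi> (\<lambda>f x. indicator {-R..R} x * T f x)"
  unfolding L2_compact_op_iff
proof
  obtain B where B: "B > 0" "\<And>x y. t x y \<le> B" by (rule t_boundedE) blast
  obtain C where C: "C > 0"
    "\<And>f. f \<in> L2 \<pi> \<Longrightarrow> integrable lborel (\<lambda>y. indicator {-(R + s)..R + s} y * cmod (f y))"
    "\<And>f. f \<in> L2 \<pi> \<Longrightarrow> L2norm \<pi> f \<le> 1 \<Longrightarrow> (\<integral>y. indicator {-(R + s)..R + s} y * cmod (f y) \<partial>lborel) \<le> C"
    by (rule L2_locally_integrable[of "R + s"]) blast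
  have bound: "cmod (T f x) \<le> B * (\<integral>y. indicator {-(R + s)..R + s} y * cmod (f y) \<partial>lborel)"
    if "f \<in> L2 \<pi>" "x \<in> {-R..R}" for f x
    using T_bound[OF that(1), of x R "\<lambda>_. 0" B] that(2) B by auto
  show "L2_linear_op \<pi> (\<lambda>f x. indicator {-R..R} x * T f x)"
    unfolding L2_linear_op_def
  proof (intro conjI ballI allI)
    fix f assume f: "f \<in> L2 \<pi>"
    have [measurable]: "f \<in> borel_measurable borel" by (rule L2_measurable[OF f])
    let ?I = "\<integral>y. indicator {-(R + s)..R + s} y * cmod (f y) \<partial>lborel"
    show "(\<lambda>x. indicator {-R..R} x * T f x) \<in> L2 \<pi>"
    proof (rule L2I_bound)
      show "(cmod (indicator {-R..R} x * T f x))\<^sup>2 \<le> (B * ?I)\<^sup>2" for x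
        using bound[OF f, of x] by (cases "x \<in> {-R..R}") (auto simp: norm_mult intro!: power_mono)
    qed (auto intro: integrable_pi_measure_const)
    fix g c assume "g \<in> L2 \<pi>"
    then show "AE x in pi_measure \<pi>. indicator {-R..R} x * T (\<lambda>y. c * f y + g y) x
        = c * (indicator {-R..R} x * T f x) + indicator {-R..R} x * T g x"
      using f by (simp add: T_lincomb distrib_left mult.left_commute)
  qed
  show "L2_unit_precompact \<pi> (\<lambda>f x. indicator {-R..R} x * T f x)"
    unfolding L2_unit_precompact_def
  proof (intro allI impI)
    fix fs :: "nat \<Rightarrow> real \<Rightarrow> complex"
    assume "\<forall>n. fs n \<in> L2 \<pi> \<and> L2norm \<pi> (fs n) \<le> 1"
    then have fs: "\<And>n. fs n \<in> L2 \<pi>" "\<And>n. L2norm \<pi> (fs n) \<le> 1" by auto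
    have le: "d * (\<integral>y. indicator {-(R + s)..R + s} y * cmod (fs n y) \<partial>lborel) \<le> d * C"
      if "d \<ge> 0" for d n
      by (intro mult_left_mono C fs that)
    have equicont: "\<exists>d>0. \<forall>n y. y \<in> {-R..R} \<and> norm (x - y) < d \<longrightarrow> norm (T (fs n) x - T (fs n) y) < e"
      if x: "x \<in> {-R..R}" and e: "e > 0" for x e
    proof -
      \<comment> \<open>On the compact rectangle the modulus \<open>d\<close> does not depend on the
        integration variable. With \<open>C\<close> bounding the L1 norms, the tolerance
        \<open>e / (2 * C)\<close> yields \<open>e / 2\<close>, strictly below
        \<open>e\<close>.\<close>
      have "uniformly_continuous_on ({-R..R} \<times> {-(R + s)..R + s}) (\<lambda>z. t (fst z) (snd z))"
        by (intro compact_uniformly_continuous continuous_on_subset[OF t_continuous]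
            compact_Times compact_Icc) auto
      then obtain d where d: "d > 0"
        "\<And>z z'. z \<in> {-R..R} \<times> {-(R + s)..R + s} \<Longrightarrow> z' \<in> {-R..R} \<times> {-(R + s)..R + s} \<Longrightarrow>
           dist z' z < d \<Longrightarrow> dist (t (fst z') (snd z')) (t (fst z) (snd z)) < e / (2 * C)"
        by (rule uniformly_continuous_onE[of _ _ "e / (2 * C)"]) (use e C(1) in simp, blast)
      have "norm (T (fs n) x - T (fs n) y) < e" if y: "y \<in> {-R..R}" "norm (x - y) < d" for n y
      proof -
        have "cmod (T (fs n) x - T (fs n) y)
            \<le> e / (2 * C) * (\<integral>y. indicator {-(R + s)..R + s} y * cmod (fs n y) \<partial>lborel)"
          unfolding T_def[of "fs n" y]
        proof (rule T_bound[OF fs(1)])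
          show "\<bar>x\<bar> \<le> R" using x by auto
          show "\<bar>t x z - t y z\<bar> \<le> e / (2 * C)" if "z \<in> {-(R + s)..R + s}" for z
            using d(2)[of "(y, z)" "(x, z)"] x y that
            by (auto simp: dist_norm norm_Pair)
          show "t y z = 0" if "z \<notin> {-(R + s)..R + s}" for z
            using that y(1) by (intro t_eq_0) auto
        qed (rule T_integrand_integrable[OF fs(1)])
        also have "\<dots> \<le> e / (2 * C) * C" using e C(1) by (intro le) auto
        also have "\<dots> < e" using e C(1) by simp
        finally show ?thesis .
      qed
      then show ?thesis using d(1) by blast
    qed
    have bounded: "norm (T (fs n) x) \<le> B * C" if "x \<in> {-R..R}" for n x
      using order_trans[OF bound[OF fs(1) that] le[of B n]] B(1) by simp
    obtain g and \<phi> :: "nat \<Rightarrow> nat" where \<phi>: "strict_mono \<phi>" and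
      g: "\<And>e. 0 < e \<Longrightarrow> \<exists>N. \<forall>n x. n \<ge> N \<and> x \<in> {-R..R} \<longrightarrow> norm (T (fs (\<phi> n)) x - g x) < e"
    proof (rule Arzela_Ascoli[of "{-R..R}" "\<lambda>n. T (fs n)" "B * C", OF compact_Icc bounded equicont])
      fix g and k :: "nat \<Rightarrow> nat"
      assume "strict_mono k"
        "\<And>e. 0 < e \<Longrightarrow> \<exists>N. \<forall>n x. n \<ge> N \<and> x \<in> {-R..R} \<longrightarrow> norm (T (fs (k n)) x - g x) < e"
      then show thesis by (rule that)
    qed
    show "\<exists>\<phi>::nat \<Rightarrow> nat. strict_mono \<phi> \<and> (\<forall>e>0. \<exists>N. \<forall>m\<ge>N. \<forall>n\<ge>N.
        L2norm \<pi> (\<lambda>x. indicator {-R..R} x * T (fs (\<phi> m)) x - indicator {-R..R} x * T (fs (\<phi> n)) x) < e)"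
    proof (intro exI[of _ \<phi>] conjI allI impI \<phi>)
      fix e :: real assume e: "e > 0"
      \<comment> \<open>The uniform limit \<open>g\<close> serves only as a pivot: two errors below
        \<open>e / 4\<close> give a pointwise difference of at most \<open>e / 2\<close>, which is
        then compared with a constant function.\<close>
      then obtain N where N: "\<And>n x. n \<ge> N \<Longrightarrow> x \<in> {-R..R} \<Longrightarrow> norm (T (fs (\<phi> n)) x - g x) < e / 4"
        using g[of "e / 4"] by auto
      show "\<exists>N. \<forall>m\<ge>N. \<forall>n\<ge>N. L2norm \<pi> (\<lambda>x. indicator {-R..R} x * T (fs (\<phi> m)) x
          - indicator {-R..R} x * T (fs (\<phi> n)) x) < e"
      proof (intro exI[of _ N] allI impI)
        fix m n assume mn: "m \<ge> N" "n \<ge> N"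
        let ?h = "\<lambda>x. indicator {-R..R} x * T (fs (\<phi> m)) x - indicator {-R..R} x * T (fs (\<phi> n)) x"
        have h: "cmod (?h x) \<le> e / 2" for x
        proof (cases "x \<in> {-R..R}")
          case True
          then have eq: "?h x = (T (fs (\<phi> m)) x - g x) - (T (fs (\<phi> n)) x - g x)" by simp
          show ?thesis
            unfolding eq using norm_triangle_ineq4[of "T (fs (\<phi> m)) x - g x" "T (fs (\<phi> n)) x - g x"]
              N[OF mn(1) True] N[OF mn(2) True] by linarith
        qed (use e in simp)
        have [measurable]: "T (fs k) \<in> borel_measurable borel" for k
          by (intro T_measurable L2_measurable[OF fs(1)])
        have const: "(\<lambda>x. complex_of_real (e / 2)) \<in> L2 \<pi>"
          by (rule L2I_bound[OF _ integrable_pi_measure_const[of "(e / 2)\<^sup>2"]])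
            (use e in \<open>auto simp: norm_divide\<close>)
        have "?h \<in> L2 \<pi>"
          by (rule L2I_bound[OF _ integrable_pi_measure_const[of "(e / 2)\<^sup>2"]])
            (measurable, intro power_mono h norm_ge_zero)
        then have "L2norm \<pi> ?h \<le> L2norm \<pi> (\<lambda>x. complex_of_real (e / 2))"
          using h e by (intro L2norm_mono_AE const AE_I2) (auto simp: norm_divide)
        also have "\<dots> = e / 2"
          unfolding L2norm_def using e
          by (subst integral_pi_measure) (auto simp: norm_divide pi_one)
        also have "\<dots> < e" using e by simp
        finally show "L2norm \<pi> ?h < e" .
      qed
    qed
  qed
qed

section \<open>The integral operator outside [-a, a]\<close>

definition sup_kernel :: "real \<Rightarrow> real \<Rightarrow> real" where
  "sup_kernel a u = (SUP x\<in>{x. \<bar>x\<bar> > a}. sqrt (t x (x + u) * t (x + u) x))"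

text \<open>Written with an indicator on the whole line, so that it is the total mass of a
  convolution kernel; \<open>beta_eq_interval_integral\<close> returns to the interval form.\<close>

definition beta :: "real \<Rightarrow> real" where
  "beta a = (\<integral>u. indicator {-s..s} u * sup_kernel a u \<partial>lborel)"

lemma outside_nonempty: "{x::real. \<bar>x\<bar> > a} \<noteq> {}"
proof -
  have "\<bar>a\<bar> + 1 \<in> {x::real. \<bar>x\<bar> > a}" by auto
  then show ?thesis by blast
qed

lemma sqrt_t_le:
  assumes "\<And>x y. t x y \<le> B"
  shows "sqrt (t x y * t y x) \<le> B"
proof -
  have "t x y * t y x \<le> B * B"
    using assms[of x y] assms[of y x] order_trans[OF t_nonneg assms] by (intro mult_mono) auto
  then show ?thesis
    using order_trans[OF t_nonneg assms] by (intro real_le_lsqrt) (auto simp: power2_eq_square)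
qed

lemma sup_kernel_bdd: "bdd_above ((\<lambda>x. sqrt (t x (x + u) * t (x + u) x)) ` {x. \<bar>x\<bar> > a})"
proof -
  obtain B where "\<And>x y. t x y \<le> B" by (rule t_boundedE) blast
  then show ?thesis by (intro bdd_aboveI2[where M = B] sqrt_t_le)
qed

lemma sqrt_t_le_sup_kernel: "\<bar>x\<bar> > a \<Longrightarrow> sqrt (t x (x + u) * t (x + u) x) \<le> sup_kernel a u"
  unfolding sup_kernel_def by (intro cSUP_upper sup_kernel_bdd) auto

lemma sup_kernel_nonneg: "sup_kernel a u \<ge> 0"
proof -
  have "0 \<le> sqrt (t (\<bar>a\<bar> + 1) (\<bar>a\<bar> + 1 + u) * t (\<bar>a\<bar> + 1 + u) (\<bar>a\<bar> + 1))" by simp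
  also have "\<dots> \<le> sup_kernel a u" by (rule sqrt_t_le_sup_kernel) auto
  finally show ?thesis .
qed

text \<open>A supremum of continuous functions is lower semicontinuous.\<close>

lemma sup_kernel_measurable [measurable]: "sup_kernel a \<in> borel_measurable borel"
proof (rule borel_measurableI_greater)
  fix y
  have "{u. y < sup_kernel a u} = (\<Union>x\<in>{x. \<bar>x\<bar> > a}. {u. y < sqrt (t x (x + u) * t (x + u) x)})"
    unfolding sup_kernel_def by (auto simp: less_cSUP_iff[OF outside_nonempty sup_kernel_bdd])
  moreover have "open {u. y < sqrt (t x (x + u) * t (x + u) x)}" for x
    by (intro open_Collect_less continuous_intros continuous_on_t)
  ultimately have "open {u. y < sup_kernel a u}" by (simp add: open_UN)
  then show "{u \<in> space borel. y < sup_kernel a u} \<in> sets borel" by simp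
qed

lemma sup_kernel_integrable: "integrable lborel (\<lambda>u. indicator {-s..s} u * sup_kernel a u)"
proof -
  obtain B where B: "B > 0" "\<And>x y. t x y \<le> B" by (rule t_boundedE) blast
  have "sup_kernel a u \<le> B" for u
    unfolding sup_kernel_def by (intro cSUP_least outside_nonempty sqrt_t_le B)
  moreover have "integrable lborel (\<lambda>u. B * indicator {-s..s} u)"
    by (intro integrable_mult_right integrable_real_indicator) (auto simp: emeasure_lborel_Icc_eq)
  ultimately show ?thesis
    using B(1) sup_kernel_nonneg
    by (elim Bochner_Integration.integrable_bound) (auto simp: indicator_def)
qed

lemma beta_nonneg: "beta a \<ge> 0"
  unfolding beta_def by (intro integral_nonneg_AE) (auto simp: sup_kernel_nonneg)

lemma beta_eq_interval_integral:
  "(LBINT u=-s..s. (SUP x\<in>{x. \<bar>x\<bar> > a}. sqrt (t x (x + u) * t (x + u) x))) = beta a"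
  using interval_integral_Icc[of "-s" s "sup_kernel a"] s_pos
  by (simp add: beta_def sup_kernel_def set_lebesgue_integral_def)

text \<open>Conjugating with \<open>sqrt \<pi>\<close> turns \<open>T\<close> into an operator on \<open>L\<^sup>2(dx)\<close> with kernel
  \<open>sqrt (t(x,y) t(y,x))\<close>, which for \<open>\<bar>x\<bar> > a\<close> is dominated by a convolution.\<close>

lemma T_outside:
  assumes f: "f \<in> L2 \<pi>"
  shows "(\<lambda>x. indicator {x. \<bar>x\<bar> > a} x * T f x) \<in> L2 \<pi>"
    and "L2norm \<pi> (\<lambda>x. indicator {x. \<bar>x\<bar> > a} x * T f x) \<le> beta a * L2norm \<pi> f"
proof -
  have [measurable]: "f \<in> borel_measurable borel" by (rule L2_measurable[OF f])
  \<comment> \<open>\<open>k\<close> is the convolution kernel of mass \<open>beta a\<close>, and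
    \<open>h\<close> is the image of \<open>|f|\<close> in L2(dx). Both take values in
    \<open>ennreal\<close>, so that Fubini and Cauchy--Schwarz apply before integrability is
    established.\<close>
  define k where "k u = ennreal (indicator {-s..s} u * sup_kernel a u)" for u
  define h where "h x = ennreal (cmod (f x) * sqrt (\<pi> x))" for x
  define g where "g = (\<lambda>x. indicator {x. \<bar>x\<bar> > a} x * T f x)"
  have [measurable]: "k \<in> borel_measurable borel" "h \<in> borel_measurable borel" "g \<in> borel_measurable borel"
    unfolding k_def[abs_def] h_def[abs_def] g_def by measurable
  have k_int: "(\<integral>\<^sup>+u. k u \<partial>lborel) = ennreal (beta a)"
    unfolding k_def beta_def
    by (rule nn_integral_eq_integral[OF sup_kernel_integrable]) (simp add: sup_kernel_nonneg)
  have sq: "ennreal (c * sqrt (\<pi> x)) * ennreal (c * sqrt (\<pi> x)) = ennreal (\<pi> x) * ennreal (c\<^sup>2)"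
    if "c \<ge> 0" for c x
    using that pi_pos[of x]
    by (simp add: ennreal_mult'[symmetric] power2_eq_square algebra_simps flip: ennreal_mult'')
  have h_int: "(\<integral>\<^sup>+x. h x * h x \<partial>lborel) = ennreal ((L2norm \<pi> f)\<^sup>2)"
  proof -
    have "(\<integral>\<^sup>+x. h x * h x \<partial>lborel) = (\<integral>\<^sup>+x. ennreal (\<pi> x) * ennreal ((cmod (f x))\<^sup>2) \<partial>lborel)"
      unfolding h_def by (simp add: sq)
    also have "\<dots> = (\<integral>\<^sup>+x. ennreal ((cmod (f x))\<^sup>2) \<partial>pi_measure \<pi>)"
      unfolding pi_measure_def by (subst nn_integral_density) auto
    also have "\<dots> = ennreal ((L2norm \<pi> f)\<^sup>2)"
      unfolding L2norm_power2 by (rule nn_integral_eq_integral[OF L2_integrable[OF f]]) simp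
    finally show ?thesis .
  qed
  have pointwise: "ennreal (cmod (g x) * sqrt (\<pi> x)) \<le> (\<integral>\<^sup>+u. k u * h (x + u) \<partial>lborel)" for x
  proof (cases "\<bar>x\<bar> > a")
    case True
    have "ennreal (cmod (g x) * sqrt (\<pi> x)) = ennreal (cmod (T f x)) * ennreal (sqrt (\<pi> x))"
      using True by (simp add: g_def ennreal_mult')
    also have "\<dots> \<le> (\<integral>\<^sup>+y. ennreal (cmod (f y * complex_of_real (t x y))) \<partial>lborel) * ennreal (sqrt (\<pi> x))"
      unfolding T_def by (intro mult_right_mono integral_norm_bound_ennreal T_integrand_integrable f) simp
    also have "\<dots> = (\<integral>\<^sup>+y. ennreal (cmod (f y * complex_of_real (t x y))) * ennreal (sqrt (\<pi> x)) \<partial>lborel)"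
      by (rule nn_integral_multc[symmetric]) measurable
    also have "\<dots> = (\<integral>\<^sup>+u. ennreal (cmod (f (x + u) * complex_of_real (t x (x + u)))) * ennreal (sqrt (\<pi> x)) \<partial>lborel)"
      by (subst nn_integral_real_affine[where c = 1 and t = x]) (auto simp: T_def)
    also have "\<dots> \<le> (\<integral>\<^sup>+u. k u * h (x + u) \<partial>lborel)"
    proof (rule nn_integral_mono)
      fix u
      \<comment> \<open>Detailed balance moves the weight from \<open>x\<close> to
        \<open>x + u\<close>, which completes \<open>h (x + u)\<close> and leaves the symmetrised
        kernel, bounded by its supremum over \<open>|x| > a\<close>.\<close>
      have "cmod (f (x + u)) * (t x (x + u) * sqrt (\<pi> x))
          = cmod (f (x + u)) * (sqrt (t x (x + u) * t (x + u) x) * sqrt (\<pi> (x + u)))"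
        by (simp add: t_mult_sqrt)
      also have "\<dots> \<le> indicator {-s..s} u * sup_kernel a u * (cmod (f (x + u)) * sqrt (\<pi> (x + u)))"
      proof (cases "u \<in> {-s..s}")
        case True': True
        have "sqrt (t x (x + u) * t (x + u) x) * (cmod (f (x + u)) * sqrt (\<pi> (x + u)))
            \<le> sup_kernel a u * (cmod (f (x + u)) * sqrt (\<pi> (x + u)))"
          using pi_pos[of "x + u"] by (intro mult_right_mono sqrt_t_le_sup_kernel True) auto
        then show ?thesis using True' by (simp add: ac_simps)
      next
        case False
        then have "t x (x + u) = 0" by (intro t_eq_0) auto
        then show ?thesis using False by simp
      qed
      finally have "cmod (f (x + u)) * t x (x + u) * sqrt (\<pi> x)
          \<le> indicator {-s..s} u * sup_kernel a u * (cmod (f (x + u)) * sqrt (\<pi> (x + u)))"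
        by (simp add: mult.assoc)
      then show "ennreal (cmod (f (x + u) * complex_of_real (t x (x + u)))) * ennreal (sqrt (\<pi> x)) \<le> k u * h (x + u)"
        unfolding k_def h_def
        by (subst (1 2) ennreal_mult'[symmetric])
          (auto simp: norm_mult sup_kernel_nonneg intro!: ennreal_leI)
    qed
    finally show ?thesis .
  qed (simp add: g_def)
  have "(\<integral>\<^sup>+x. ennreal ((cmod (g x))\<^sup>2) \<partial>pi_measure \<pi>)
      = (\<integral>\<^sup>+x. ennreal (cmod (g x) * sqrt (\<pi> x)) * ennreal (cmod (g x) * sqrt (\<pi> x)) \<partial>lborel)"
    unfolding pi_measure_def by (subst nn_integral_density) (auto simp: sq)
  also have "\<dots> \<le> (\<integral>\<^sup>+x. (\<integral>\<^sup>+u. k u * h (x + u) \<partial>lborel) * (\<integral>\<^sup>+u. k u * h (x + u) \<partial>lborel) \<partial>lborel)"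
    by (intro nn_integral_mono mult_mono pointwise) auto
  \<comment> \<open>Young's inequality for a convolution: the mass of \<open>k\<close> appears once
    here, and once more after Fubini and translation invariance, giving the square of
    \<open>beta a\<close>.\<close>
  also have "\<dots> \<le> (\<integral>\<^sup>+x. (\<integral>\<^sup>+u. k u \<partial>lborel) * (\<integral>\<^sup>+u. k u * (h (x + u) * h (x + u)) \<partial>lborel) \<partial>lborel)"
    by (intro nn_integral_mono nn_integral_weighted_square_le) measurable
  also have "\<dots> = ennreal (beta a) * (\<integral>\<^sup>+x. (\<integral>\<^sup>+u. k u * (h (x + u) * h (x + u)) \<partial>lborel) \<partial>lborel)"
    unfolding k_int by (rule nn_integral_cmult) measurable
  also have "(\<integral>\<^sup>+x. (\<integral>\<^sup>+u. k u * (h (x + u) * h (x + u)) \<partial>lborel) \<partial>lborel)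
      = (\<integral>\<^sup>+u. (\<integral>\<^sup>+x. k u * (h (x + u) * h (x + u)) \<partial>lborel) \<partial>lborel)"
    by (rule lborel_pair.Fubini'[symmetric]) measurable
  also have "\<dots> = (\<integral>\<^sup>+u. k u * (\<integral>\<^sup>+x. h x * h x \<partial>lborel) \<partial>lborel)"
  proof (rule nn_integral_cong)
    fix u
    have "(\<integral>\<^sup>+x. k u * (h (x + u) * h (x + u)) \<partial>lborel) = k u * (\<integral>\<^sup>+x. h (x + u) * h (x + u) \<partial>lborel)"
      by (rule nn_integral_cmult) measurable
    also have "(\<integral>\<^sup>+x. h (x + u) * h (x + u) \<partial>lborel) = (\<integral>\<^sup>+x. h x * h x \<partial>lborel)"
      using nn_integral_real_affine[of "\<lambda>x. h x * h x" 1 u] by (simp add: add.commute)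
    finally show "(\<integral>\<^sup>+x. k u * (h (x + u) * h (x + u)) \<partial>lborel) = k u * (\<integral>\<^sup>+x. h x * h x \<partial>lborel)" .
  qed
  also have "\<dots> = ennreal (beta a) * ennreal ((L2norm \<pi> f)\<^sup>2)"
    by (simp add: nn_integral_multc k_int h_int)
  also have "ennreal (beta a) * (ennreal (beta a) * ennreal ((L2norm \<pi> f)\<^sup>2)) = ennreal ((beta a * L2norm \<pi> f)\<^sup>2)"
    using beta_nonneg[of a] by (simp add: power2_eq_square ac_simps flip: ennreal_mult'')
  finally have main: "(\<integral>\<^sup>+x. ennreal ((cmod (g x))\<^sup>2) \<partial>pi_measure \<pi>) \<le> ennreal ((beta a * L2norm \<pi> f)\<^sup>2)" .
  have gm: "(\<lambda>x. (cmod (g x))\<^sup>2) \<in> borel_measurable (pi_measure \<pi>)"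
    by (simp add: pi_measure_def)
  \<comment> \<open>Finiteness of the extended integral gives membership in L2, and only then can
    the estimate be restated for the real-valued \<open>L2norm\<close>.\<close>
  have int: "integrable (pi_measure \<pi>) (\<lambda>x. (cmod (g x))\<^sup>2)"
  proof (rule integrableI_bounded[OF gm])
    show "(\<integral>\<^sup>+x. ennreal (norm ((cmod (g x))\<^sup>2)) \<partial>pi_measure \<pi>) < \<infinity>"
      using le_less_trans[OF main ennreal_less_top] by simp
  qed
  show "(\<lambda>x. indicator {x. \<bar>x\<bar> > a} x * T f x) \<in> L2 \<pi>"
    unfolding g_def[symmetric] by (rule L2I_bound[OF _ int]) auto
  have "ennreal ((L2norm \<pi> g)\<^sup>2) \<le> ennreal ((beta a * L2norm \<pi> f)\<^sup>2)"
    using main nn_integral_eq_integral[OF int] by (simp add: L2norm_power2)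
  then have "(L2norm \<pi> g)\<^sup>2 \<le> (beta a * L2norm \<pi> f)\<^sup>2" by simp
  then show "L2norm \<pi> (\<lambda>x. indicator {x. \<bar>x\<bar> > a} x * T f x) \<le> beta a * L2norm \<pi> f"
    unfolding g_def[symmetric] by (rule power2_le_imp_le) (simp add: beta_nonneg)
qed

lemma L2_bounded_op_T_outside:
  "L2_bounded_op \<pi> (\<lambda>f x. indicator {x. \<bar>x\<bar> > a} x * T f x)"
  unfolding L2_bounded_op_def L2_linear_op_def
  using T_outside beta_nonneg[of a]
  by (auto simp: T_lincomb distrib_left mult.left_commute intro!: exI[of _ "beta a"])

section \<open>The decomposition of P and the norm of its diagonal part\<close>

text \<open>The part of \<open>P\<close> that does not couple \<open>[-a, a]\<close> to its complement, and on \<open>[-a, a]\<close> is the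
  multiplication by \<open>r\<close>; the rest of \<open>P\<close> is compact.\<close>

definition diag_part :: "real \<Rightarrow> (real \<Rightarrow> complex) \<Rightarrow> real \<Rightarrow> complex" where
  "diag_part a f x = complex_of_real (r x) * f x
     + indicator {x. \<bar>x\<bar> > a} x * T (\<lambda>y. indicator {x. \<bar>x\<bar> > a} y * f y) x"

text \<open>The first summand sends everything into [-a, a], the second sends [-a, a] to its
  complement. The window of radius \<open>a + s\<close> is as far as functions supported in [-a, a]
  can spread under \<open>T\<close>; writing it out exhibits both summands as compositions of one
  compact cutoff with bounded multiplications.\<close>

definition compact_part :: "real \<Rightarrow> (real \<Rightarrow> complex) \<Rightarrow> real \<Rightarrow> complex" where
  "compact_part a f x = indicator {-a..a} x * (indicator {-(a + s)..a + s} x * T f x)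
     + indicator {x. \<bar>x\<bar> > a} x
       * (indicator {-(a + s)..a + s} x * T (\<lambda>y. indicator {-a..a} y * f y) x)"

lemma L2_compact_op_compact_part: "L2_compact_op \<pi> (compact_part a)"
proof -
  note M = L2_compact_op_cutoff_T[of "a + s"]
  have A: "L2_bounded_op \<pi> (\<lambda>f x. indicator {-a..a} x * f x)"
    and A': "L2_bounded_op \<pi> (\<lambda>f x. indicator {x. \<bar>x\<bar> > a} x * f x)"
    by (rule L2_bounded_op_indicator; simp)+
  show ?thesis
    unfolding compact_part_def[abs_def]
    using L2_compact_op_add[OF L2_compact_op_comp_left[OF A M]
        L2_compact_op_comp_left[OF A' L2_compact_op_comp_right[OF M A]]] .
qed

lemma L2_bounded_op_diag_part: "L2_bounded_op \<pi> (diag_part a)"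
proof -
  have A': "L2_bounded_op \<pi> (\<lambda>f x. indicator {x. \<bar>x\<bar> > a} x * f x)"
    by (rule L2_bounded_op_indicator) simp
  have "L2_bounded_op \<pi> (\<lambda>f x. complex_of_real (r x) * f x)"
    by (rule L2_bounded_op_mult[where C = 1]) (auto simp: r_nonneg r_le_1)
  from L2_bounded_op_add[OF this L2_bounded_op_comp[OF L2_bounded_op_T_outside A']]
  show ?thesis unfolding diag_part_def[abs_def] .
qed

text \<open>Membership of \<open>f\<close> in L2 makes the integrals of both pieces converge, so
  that \<open>T f\<close> can be split at \<open>a\<close>.\<close>

lemma mh_op_decomp:
  assumes f: "f \<in> L2 \<pi>" and a: "a > 0"
  shows "mh_op \<pi> q f x = diag_part a f x + compact_part a f x"
proof (cases "\<bar>x\<bar> \<le> a")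
  case True
  then have "x \<in> {-a..a}" "x \<in> {-(a + s)..a + s}" "x \<notin> {x. \<bar>x\<bar> > a}" using s_pos by auto
  then show ?thesis by (simp add: mh_op_def T_def diag_part_def compact_part_def)
next
  case False
  have in2: "(\<lambda>y. indicator {-a..a} y * f y) \<in> L2 \<pi>" "(\<lambda>y. indicator {x. \<bar>x\<bar> > a} y * f y) \<in> L2 \<pi>"
    by (rule L2_bounded_op_in[OF L2_bounded_op_indicator f]; simp)+
  have "(\<lambda>y. 1 * (indicator {-a..a} y * f y) + indicator {x. \<bar>x\<bar> > a} y * f y) = f"
    by (auto simp: fun_eq_iff indicator_def)
  then have split: "T f x = T (\<lambda>y. indicator {-a..a} y * f y) x + T (\<lambda>y. indicator {x. \<bar>x\<bar> > a} y * f y) x"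
    using T_lincomb[OF in2, of 1 x] by simp
  \<comment> \<open>Beyond radius \<open>a + s\<close>, the point \<open>x\<close> is farther than
    \<open>s\<close> from every point of [-a, a].\<close>
  have "T (\<lambda>y. indicator {-a..a} y * f y) x = 0" if "x \<notin> {-(a + s)..a + s}"
  proof -
    have "indicator {-a..a} y * f y * complex_of_real (t x y) = 0" for y
    proof (cases "y \<in> {-a..a}")
      case True
      then have "t x y = 0" using that by (intro t_eq_0) auto
      then show ?thesis by simp
    qed simp
    then show ?thesis unfolding T_def by (simp only: integral_zero)
  qed
  then have "indicator {-(a + s)..a + s} x * T (\<lambda>y. indicator {-a..a} y * f y) x = T (\<lambda>y. indicator {-a..a} y * f y) x"
    by (cases "x \<in> {-(a + s)..a + s}") auto
  moreover have "x \<notin> {-a..a}" using False by auto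
  ultimately show ?thesis
    using False split by (simp add: mh_op_def diag_part_def compact_part_def flip: T_def)
qed

text \<open>Each block maps its own half of \<open>f\<close> with norm at most \<open>c\<close>, and
  the halves are orthogonal both before and after.\<close>

lemma diag_part_bound:
  assumes f: "f \<in> L2 \<pi>" and a: "a > 0"
    and ra: "\<And>x. \<bar>x\<bar> \<le> a \<Longrightarrow> r x \<le> c" and ra': "\<And>x. \<bar>x\<bar> > a \<Longrightarrow> r x + beta a \<le> c"
  shows "L2norm \<pi> (diag_part a f) \<le> c * L2norm \<pi> f"
proof -
  let ?A' = "{x. \<bar>x\<bar> > a}"
  have c0: "c \<ge> 0" using ra[of 0] r_nonneg[of 0] a by simp
  have sets: "{-a..a} \<in> sets borel" "?A' \<in> sets borel" by auto
  have compl: "- {-a..a} = ?A'" by auto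
  define f1 f2 where "f1 = (\<lambda>x. indicator {-a..a} x * f x)" and "f2 = (\<lambda>x. indicator ?A' x * f x)"
  have f12: "f1 \<in> L2 \<pi>" "f2 \<in> L2 \<pi>"
    unfolding f1_def f2_def by (rule L2_bounded_op_in[OF L2_bounded_op_indicator f]; simp)+
  have D: "diag_part a f \<in> L2 \<pi>" by (rule L2_bounded_op_in[OF L2_bounded_op_diag_part f])
  have "L2norm \<pi> (\<lambda>x. indicator {-a..a} x * diag_part a f x) \<le> L2norm \<pi> (\<lambda>x. complex_of_real c * f1 x)"
  proof (intro L2norm_mono_AE AE_I2)
    fix x
    show "cmod (indicator {-a..a} x * diag_part a f x) \<le> cmod (complex_of_real c * f1 x)"
      using ra[of x] r_nonneg[of x] c0
      by (cases "x \<in> {-a..a}")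
        (auto simp: diag_part_def f1_def norm_mult abs_le_iff indicator_def intro!: mult_right_mono)
  qed (intro L2_cmult f12 L2_bounded_op_in[OF L2_bounded_op_indicator D] sets)+
  then have 1: "L2norm \<pi> (\<lambda>x. indicator {-a..a} x * diag_part a f x) \<le> c * L2norm \<pi> f1"
    using c0 by (simp add: L2norm_cmult)
  \<comment> \<open>On the outer block the budget \<open>c\<close> is divided into
    \<open>c - beta a\<close> for multiplication by \<open>r\<close> and \<open>beta a\<close> for
    the integral operator.\<close>
  have le_c: "r x \<le> c - beta a" if "\<bar>x\<bar> > a" for x using ra'[OF that] by simp
  have cb: "c - beta a \<ge> 0" using le_c[of "a + 1"] r_nonneg[of "a + 1"] a by simp
  define g where "g = (\<lambda>x. complex_of_real (r x) * f2 x)"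
  have g: "g \<in> L2 \<pi>" unfolding g_def
    by (rule L2_mult_bounded[OF f12(2), where C = 1]) (auto simp: r_nonneg r_le_1)
  have "L2norm \<pi> g \<le> L2norm \<pi> (\<lambda>x. complex_of_real (c - beta a) * f2 x)"
  proof (intro L2norm_mono_AE AE_I2 g L2_cmult f12)
    fix x
    show "cmod (g x) \<le> cmod (complex_of_real (c - beta a) * f2 x)"
      using le_c[of x] r_nonneg[of x] cb
      by (cases "\<bar>x\<bar> > a")
        (auto simp: g_def f2_def norm_mult intro!: mult_right_mono simp del: of_real_diff)
  qed
  also have "\<dots> = (c - beta a) * L2norm \<pi> f2"
    unfolding L2norm_cmult using cb by (simp del: of_real_diff)
  finally have g_le: "L2norm \<pi> g \<le> (c - beta a) * L2norm \<pi> f2" .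
  have "(\<lambda>x. indicator ?A' x * diag_part a f x) = (\<lambda>x. g x + indicator ?A' x * T f2 x)"
    by (auto simp: fun_eq_iff diag_part_def g_def f2_def indicator_def)
  then have "L2norm \<pi> (\<lambda>x. indicator ?A' x * diag_part a f x)
      \<le> L2norm \<pi> g + L2norm \<pi> (\<lambda>x. indicator ?A' x * T f2 x)"
    using L2norm_triangle[OF g T_outside(1)[OF f12(2), of a]] by simp
  also have "\<dots> \<le> (c - beta a) * L2norm \<pi> f2 + beta a * L2norm \<pi> f2"
    by (intro add_mono g_le T_outside(2) f12)
  finally have 2: "L2norm \<pi> (\<lambda>x. indicator ?A' x * diag_part a f x) \<le> c * L2norm \<pi> f2"
    by (simp add: algebra_simps)
  have "(L2norm \<pi> (diag_part a f))\<^sup>2 = (L2norm \<pi> (\<lambda>x. indicator {-a..a} x * diag_part a f x))\<^sup>2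
      + (L2norm \<pi> (\<lambda>x. indicator ?A' x * diag_part a f x))\<^sup>2"
    using L2norm_split[OF D sets(1)] unfolding compl .
  also have "\<dots> \<le> (c * L2norm \<pi> f1)\<^sup>2 + (c * L2norm \<pi> f2)\<^sup>2"
    by (intro add_mono power_mono 1 2) auto
  also have "\<dots> = c\<^sup>2 * ((L2norm \<pi> f1)\<^sup>2 + (L2norm \<pi> f2)\<^sup>2)"
    by (simp add: power_mult_distrib distrib_left)
  also have "(L2norm \<pi> f1)\<^sup>2 + (L2norm \<pi> f2)\<^sup>2 = (L2norm \<pi> f)\<^sup>2"
    using L2norm_split[OF f sets(1)] unfolding compl f1_def f2_def by simp
  finally have "(L2norm \<pi> (diag_part a f))\<^sup>2 \<le> (c * L2norm \<pi> f)\<^sup>2"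
    by (simp add: power_mult_distrib)
  then show ?thesis by (rule power2_le_imp_le) (use c0 in simp)
qed

lemma ess_spec_radius_mh_op_le:
  assumes a: "a > 0"
  shows "ess_spec_radius \<pi> (mh_op \<pi> q)
    \<le> max (SUP x\<in>{x. \<bar>x\<bar> \<le> a}. r x) ((SUP x\<in>{x. \<bar>x\<bar> > a}. r x) + beta a)" (is "_ \<le> ?c")
proof -
  \<comment> \<open>With \<open>r \<le> 1\<close> both suprema are genuine upper bounds.\<close>
  have bdd: "bdd_above (r ` X)" for X by (intro bdd_aboveI2[where M = 1] r_le_1)
  have ra: "r x \<le> ?c" if "\<bar>x\<bar> \<le> a" for x
    using cSUP_upper[OF _ bdd, of x "{x. \<bar>x\<bar> \<le> a}"] that by (simp add: le_max_iff_disj)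
  have ra': "r x + beta a \<le> ?c" if "\<bar>x\<bar> > a" for x
    using cSUP_upper[OF _ bdd, of x "{x. \<bar>x\<bar> > a}"] that by (simp add: le_max_iff_disj)
  have c0: "?c \<ge> 0" using ra[of 0] r_nonneg[of 0] a by linarith
  have decomp: "mh_op \<pi> q f = (\<lambda>x. diag_part a f x + compact_part a f x)" if "f \<in> L2 \<pi>" for f
    using mh_op_decomp[OF that a] by (rule ext)
  have P: "L2_bounded_op \<pi> (mh_op \<pi> q)"
    by (rule L2_bounded_op_cong[OF L2_bounded_op_add[OF L2_bounded_op_diag_part[of a]
            L2_compact_op_bounded[OF L2_compact_op_compact_part[of a]]] decomp[symmetric]])
  have "ess_spec_radius \<pi> (mh_op \<pi> q) \<le> ess_norm \<pi> (mh_op \<pi> q)"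
    by (rule ess_spec_radius_le_ess_norm[OF P])
  also have "\<dots> \<le> L2_opnorm \<pi> (\<lambda>f x. mh_op \<pi> q f x - compact_part a f x)"
    by (rule ess_norm_le[OF P L2_compact_op_compact_part])
  also have "\<dots> \<le> ?c"
  proof (rule L2_opnorm_le[OF c0])
    fix f assume f: "f \<in> L2 \<pi>"
    show "L2norm \<pi> (\<lambda>x. mh_op \<pi> q f x - compact_part a f x) \<le> ?c * L2norm \<pi> f"
      unfolding decomp[OF f] using diag_part_bound[OF f a ra ra'] by simp
  qed
  finally show ?thesis .
qed

end

theorem theorem2p1:
  fixes \<pi> :: "real \<Rightarrow> real" and q :: "real \<Rightarrow> real \<Rightarrow> real" and s a :: real
  assumes pi_pos: "\<And>x. \<pi> x > 0"
    and pi_cont: "continuous_on UNIV \<pi>"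
    and pi_int: "integrable lborel \<pi>"
    and pi_one: "(\<integral>x. \<pi> x \<partial>lborel) = 1"
    and q_nonneg: "\<And>x y. q x y \<ge> 0"
    and q_bdd: "\<exists>B. \<forall>x y. q x y \<le> B"
    and q_cont: "continuous_on UNIV (\<lambda>(x, y). q x y)"
    and q_int: "\<And>x. integrable lborel (q x)"
    and q_one: "\<And>x. (\<integral>y. q x y \<partial>lborel) = 1"
    and s_pos: "s > 0"
    and q_supp: "\<And>x u. \<bar>u\<bar> > s \<Longrightarrow> q x (x + u) = 0"
    and a_pos: "a > 0"
  shows "ess_spec_radius \<pi> (mh_op \<pi> q) \<le>
           max (SUP x\<in>{x. \<bar>x\<bar> \<le> a}. mh_r \<pi> q x)
               ((SUP x\<in>{x. \<bar>x\<bar> > a}. mh_r \<pi> q x)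
                + (LBINT u=-s..s. (SUP x\<in>{x. \<bar>x\<bar> > a}.
                      sqrt (mh_t \<pi> q x (x + u) * mh_t \<pi> q (x + u) x))))"
proof -
  interpret metropolis_hastings \<pi> q s
    by unfold_locales (fact assms)+
  show ?thesis
    unfolding beta_eq_interval_integral by (rule ess_spec_radius_mh_op_le[OF a_pos])
qed

end
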